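(* Let $I\subseteq[0,\infty)$ be a closed interval of positive length, and let $\{X_1(t),\,t\geq 0\}$ and $\{X_2(t),\,t\geq 0\}$ be dilatively stable processes with stationary increments and parameters $(H_1,\delta_1)$ and $(H_2,\delta_2)$, respectively, both with zero mean and having sample paths in $C(I)$ almost surely, such that for each $i\in\{1,2\}$: if $\delta_i\geq 0$, then the distribution of $X_i(1)$ has a Gaussian component. Then $H_1\neq H_2$ implies that $X_1$ and $X_2$ are singular on $I$, i.e. $X_1\,\bot\,X_2$.
   Context: A process $\{X(t),t\ge0\}$ is real-valued; $\overset{\mathrm{fd}}{\sim}$ denotes equality of all finite-dimensional distributions. For a process $X$ all of whose finite-dimensional distributions are infinitely divisible and for $c>0$, $X^{\circledast c}=\{X(t),t\ge0\}^{\circledast c}$ denotes a process whose finite-dimensional distributions are the $c$-th convolution powers of the corresponding finite-dimensional distributions of $X$ (i.e. characteristic functions are raised to the power $c$). Let $\alpha>0$ and $\delta\leq 2\alpha$. A process $\{X(t),t\ge 0\}$ starting from zero ($X(0)=0$) is called $(\alpha,\delta)$-dilatively stable (dilatively stable with parameters $(\alpha,\delta)$) if its finite-dimensional distributions are infinitely divisible, $X(1)$ is non-Gaussian, $X(t)$ has finite moments of all orders for all $t\ge0$, and for all $T>0$, $X(T\,\cdot\,)\overset{\mathrm{fd}}{\sim}T^{\alpha-\delta/2}X^{\circledast T^\delta}(\,\cdot\,)$. In the stationary increments case the parameter $\alpha$ is denoted by $H$. Stationary increments means that for every $s\ge0$ the processes $\{X(t+s)-X(s),t\ge0\}$ and $\{X(t)-X(0),t\ge0\}$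 have the same finite-dimensional distributions. Zero mean means $\mathsf{E}X(t)=0$ for all $t\geq 0$. An infinitely divisible distribution is said to have a Gaussian component if in its Lévy–Khintchine representation the Gaussian part has positive variance. $C(I)$ denotes the set of continuous real functions on the closed interval $I\subseteq[0,\infty)$ with the local uniform topology and Borel $\sigma$-algebra $\mathcal{B}(C(I))$. If $\{X_1(t),t\in I\}$ and $\{X_2(t),t\in I\}$ have sample paths in $C(I)$ a.s., they are called singular on $I$ ($X_1\,\bot\,X_2$) if their distributions $\mathsf{P}_{X_1},\mathsf{P}_{X_2}$ on $(C(I),\mathcal{B}(C(I)))$ are singular, i.e. there is $A\in\mathcal{B}(C(I))$ with $\mathsf{P}_{X_1}(A)=1$ and $\mathsf{P}_{X_2}(A)=0$. *)

theory Defs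
  imports "HOL-Probability.Probability"
begin

section \<open>Laws on finite powers of the real line\<close>

text \<open>
  A law on \<open>\<real>\<^sup>J\<close>, for a finite index set \<open>J\<close>, is a probability measure on the product
  space \<open>Pi\<^sub>M J (\<lambda>_. borel)\<close>, whose elements are the functions that are \<open>undefined\<close> off \<open>J\<close>.
\<close>

definition law_on :: "'i set \<Rightarrow> ('i \<Rightarrow> real) measure \<Rightarrow> bool" where
  "law_on J \<mu> \<longleftrightarrow> prob_space \<mu> \<and> sets \<mu> = sets (Pi\<^sub>M J (\<lambda>_. borel))"

definition char_fun :: "'i set \<Rightarrow> ('i \<Rightarrow> real) measure \<Rightarrow> ('i \<Rightarrow> real) \<Rightarrow> complex" where
  "char_fun J \<mu> u = (CLINT x|\<mu>. iexp (\<Sum>j\<in>J. u j * x j))"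

text \<open>\<open>\<mu>\<close> is, for every \<open>n \<ge> 1\<close>, the law of a sum of \<open>n\<close> i.i.d. random vectors.\<close>

definition infinitely_divisible :: "'i set \<Rightarrow> ('i \<Rightarrow> real) measure \<Rightarrow> bool" where
  "infinitely_divisible J \<mu> \<longleftrightarrow>
     (\<forall>n::nat. n \<ge> 1 \<longrightarrow>
        (\<exists>\<nu>. law_on J \<nu> \<and>
             \<mu> = distr (Pi\<^sub>M {..<n} (\<lambda>_. \<nu>)) (Pi\<^sub>M J (\<lambda>_. borel)) (\<lambda>x. \<lambda>j\<in>J. \<Sum>i<n. x i j)))"

text \<open>
  \<open>\<nu>\<close> is the \<open>c\<close>-th convolution power of \<open>\<mu>\<close>: the characteristic function of \<open>\<nu>\<close> is that of
  \<open>\<mu>\<close> raised to the power \<open>c\<close>. As usual, the power is taken with the distinguished logarithm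
  \<open>\<psi>\<close>, the unique continuous logarithm vanishing at \<open>0\<close> (the principal logarithm would give
  the wrong branch). It exists for every infinitely divisible \<open>\<mu>\<close>.
\<close>

definition convolution_power ::
    "'i set \<Rightarrow> real \<Rightarrow> ('i \<Rightarrow> real) measure \<Rightarrow> ('i \<Rightarrow> real) measure \<Rightarrow> bool" where
  "convolution_power J c \<mu> \<nu> \<longleftrightarrow>
     law_on J \<nu> \<and>
     (\<exists>\<psi>. continuous_map (powertop_real J) (euclidean :: complex topology) \<psi> \<and>
          \<psi> (\<lambda>j\<in>J. 0) = 0 \<and>
          (\<forall>u \<in> (\<Pi>\<^sub>E j\<in>J. UNIV). char_fun J \<mu> u = exp (\<psi> u)) \<and>
          (\<forall>u \<in> (\<Pi>\<^sub>E j\<in>J. UNIV). char_fun J \<nu> u = exp (complex_of_real c * \<psi> u)))"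


section \<open>Real distributions\<close>

text \<open>
  Degenerate laws count as Gaussian (variance zero). Otherwise the zero process would be
  dilatively stable for every pair of parameters.
\<close>

definition gaussian :: "real measure \<Rightarrow> bool" where
  "gaussian \<mu> \<longleftrightarrow>
     (\<exists>m. \<mu> = return borel m) \<or>
     (\<exists>m \<sigma>. \<sigma> > 0 \<and> \<mu> = density lborel (\<lambda>x. ennreal (normal_density m \<sigma> x)))"

definition levy_measure :: "real measure \<Rightarrow> bool" where
  "levy_measure \<Lambda> \<longleftrightarrow>
     sets \<Lambda> = sets borel \<and> emeasure \<Lambda> {0} = 0 \<and> (\<integral>\<^sup>+x. ennreal (min 1 (x\<^sup>2)) \<partial>\<Lambda>) < \<infinity>"

text \<open>
  The Levy--Khintchine representation with drift \<open>b\<close>, Gaussian variance \<open>v\<close> and Levy measure \<open>\<Lambda>\<close>.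
  The triple is unique (for the truncation function used here), and \<open>v\<close> does not depend on the
  choice of truncation function.
\<close>

definition levy_khintchine :: "real measure \<Rightarrow> real \<Rightarrow> real \<Rightarrow> real measure \<Rightarrow> bool" where
  "levy_khintchine \<mu> b v \<Lambda> \<longleftrightarrow>
     v \<ge> 0 \<and> levy_measure \<Lambda> \<and>
     (\<forall>u. char \<mu> u =
        exp (\<i> * complex_of_real (b * u) - complex_of_real (v * u\<^sup>2 / 2) +
             (CLINT x|\<Lambda>. iexp (u * x) - 1 - \<i> * complex_of_real (u * x * indicator {-1..1} x))))"

definition has_gaussian_component :: "real measure \<Rightarrow> bool" where
  "has_gaussian_component \<mu> \<longleftrightarrow> (\<exists>b v \<Lambda>. levy_khintchine \<mu> b v \<Lambda> \<and> v > 0)"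


section \<open>Processes\<close>

text \<open>
  A process is a family \<open>X\<close> on a probability space \<open>M\<close>, of which only the values \<open>X t\<close> with
  \<open>t \<ge> 0\<close> matter.
\<close>

definition real_process :: "'a measure \<Rightarrow> (real \<Rightarrow> 'a \<Rightarrow> real) \<Rightarrow> bool" where
  "real_process M X \<longleftrightarrow> prob_space M \<and> (\<forall>t\<ge>0. X t \<in> borel_measurable M)"

definition fdd :: "'a measure \<Rightarrow> (real \<Rightarrow> 'a \<Rightarrow> real) \<Rightarrow> real set \<Rightarrow> (real \<Rightarrow> real) measure" where
  "fdd M X J = distr M (Pi\<^sub>M J (\<lambda>_. borel)) (\<lambda>\<omega>. \<lambda>t\<in>J. X t \<omega>)"

definition same_fdd ::
    "'a measure \<Rightarrow> (real \<Rightarrow> 'a \<Rightarrow> real) \<Rightarrow> 'b measure \<Rightarrow> (real \<Rightarrow> 'b \<Rightarrow> real) \<Rightarrow> bool" where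
  "same_fdd M X N Y \<longleftrightarrow> (\<forall>J. finite J \<and> J \<subseteq> {0..} \<longrightarrow> fdd M X J = fdd N Y J)"

definition infinitely_divisible_process :: "'a measure \<Rightarrow> (real \<Rightarrow> 'a \<Rightarrow> real) \<Rightarrow> bool" where
  "infinitely_divisible_process M X \<longleftrightarrow>
     (\<forall>J. finite J \<and> J \<subseteq> {0..} \<longrightarrow> infinitely_divisible J (fdd M X J))"

definition convolution_power_process ::
    "'a measure \<Rightarrow> (real \<Rightarrow> 'a \<Rightarrow> real) \<Rightarrow> real \<Rightarrow> 'b measure \<Rightarrow> (real \<Rightarrow> 'b \<Rightarrow> real) \<Rightarrow> bool" where
  "convolution_power_process M X c N Y \<longleftrightarrow>
     real_process N Y \<and>
     (\<forall>J. finite J \<and> J \<subseteq> {0..} \<longrightarrow> convolution_power J c (fdd M X J) (fdd N Y J))"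

text \<open>
  The process \<open>Y\<close> is only determined up to its finite-dimensional distributions, so it may be
  taken on the sample space of all functions \<open>real \<Rightarrow> real\<close>; quantifying over \<open>N\<close> of this type
  loses no generality.
\<close>

definition dilatively_stable ::
    "real \<Rightarrow> real \<Rightarrow> 'a measure \<Rightarrow> (real \<Rightarrow> 'a \<Rightarrow> real) \<Rightarrow> bool" where
  "dilatively_stable \<alpha> \<delta> M X \<longleftrightarrow>
     \<alpha> > 0 \<and> \<delta> \<le> 2 * \<alpha> \<and>
     real_process M X \<and>
     (AE \<omega> in M. X 0 \<omega> = 0) \<and>
     infinitely_divisible_process M X \<and>
     \<not> gaussian (distr M borel (X 1)) \<and>
     (\<forall>t\<ge>0. \<forall>n::nat. integrable M (\<lambda>\<omega>. \<bar>X t \<omega>\<bar> ^ n)) \<and>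
     (\<forall>T>0. \<exists>(N :: (real \<Rightarrow> real) measure) Y.
        convolution_power_process M X (T powr \<delta>) N Y \<and>
        same_fdd M (\<lambda>t. X (T * t)) N (\<lambda>t \<omega>. T powr (\<alpha> - \<delta> / 2) * Y t \<omega>))"

definition stationary_increments :: "'a measure \<Rightarrow> (real \<Rightarrow> 'a \<Rightarrow> real) \<Rightarrow> bool" where
  "stationary_increments M X \<longleftrightarrow>
     (\<forall>s\<ge>0. same_fdd M (\<lambda>t \<omega>. X (t + s) \<omega> - X s \<omega>) M (\<lambda>t \<omega>. X t \<omega> - X 0 \<omega>))"

definition zero_mean :: "'a measure \<Rightarrow> (real \<Rightarrow> 'a \<Rightarrow> real) \<Rightarrow> bool" where
  "zero_mean M X \<longleftrightarrow> (\<forall>t\<ge>0. integral\<^sup>L M (X t) = 0)"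


section \<open>Path space and singularity\<close>

definition C_space :: "real set \<Rightarrow> (real \<Rightarrow> real) set" where
  "C_space I = {f \<in> extensional I. continuous_on I f}"

definition local_uniform_topology :: "real set \<Rightarrow> (real \<Rightarrow> real) topology" where
  "local_uniform_topology I = topology_generated_by
     {{g \<in> C_space I. \<forall>x\<in>K. \<bar>g x - f x\<bar> < \<epsilon>} | f K \<epsilon>.
        f \<in> C_space I \<and> compact K \<and> K \<subseteq> I \<and> \<epsilon> > 0}"

lemma topspace_local_uniform_topology: "topspace (local_uniform_topology I) = C_space I"
proof -
  have "C_space I \<in> {{g \<in> C_space I. \<forall>x\<in>K. \<bar>g x - f x\<bar> < \<epsilon>} | f K \<epsilon>.
        f \<in> C_space I \<and> compact K \<and> K \<subseteq> I \<and> \<epsilon> > 0}"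
  proof -
    have "(\<lambda>x\<in>I. 0) \<in> C_space I"
      by (auto simp: C_space_def cong: continuous_on_cong_simp)
    then show ?thesis
      by (intro CollectI exI[of _ "\<lambda>x\<in>I. 0"] exI[of _ "{}"] exI[of _ 1]) auto
  qed
  then show ?thesis
    unfolding local_uniform_topology_def topology_generated_by_topspace by blast
qed

definition borel_C :: "real set \<Rightarrow> (real \<Rightarrow> real) measure" where
  "borel_C I = sigma (C_space I) {U. openin (local_uniform_topology I) U}"

definition ae_continuous_paths ::
    "'a measure \<Rightarrow> (real \<Rightarrow> 'a \<Rightarrow> real) \<Rightarrow> real set \<Rightarrow> bool" where
  "ae_continuous_paths M X I \<longleftrightarrow> (AE \<omega> in M. continuous_on I (\<lambda>t. X t \<omega>))"

text \<open>
  The distribution of a process with almost surely continuous paths on \<open>I\<close>. On the exceptional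
  null set the path is replaced by the zero function; the completion makes the resulting map
  measurable even if that set is not in \<open>sets M\<close>.
\<close>

definition path_law :: "'a measure \<Rightarrow> (real \<Rightarrow> 'a \<Rightarrow> real) \<Rightarrow> real set \<Rightarrow> (real \<Rightarrow> real) measure" where
  "path_law M X I = distr (completion M) (borel_C I)
     (\<lambda>\<omega>. if continuous_on I (\<lambda>t. X t \<omega>) then (\<lambda>t\<in>I. X t \<omega>) else (\<lambda>t\<in>I. 0))"

definition singular_on ::
    "real set \<Rightarrow> 'a measure \<Rightarrow> (real \<Rightarrow> 'a \<Rightarrow> real) \<Rightarrow> 'b measure \<Rightarrow> (real \<Rightarrow> 'b \<Rightarrow> real) \<Rightarrow> bool" where
  "singular_on I M X N Y \<longleftrightarrow>
     (\<exists>A \<in> sets (borel_C I). emeasure (path_law M X I) A = 1 \<and> emeasure (path_law N Y I) A = 0)"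

end

theory Submission
  imports Defs
begin

text \<open>
  Write \<open>Y T = T powr - H * (X (a + T) - X a)\<close>. Dilative stability and stationarity of the increments
  give \<open>Y T\<close> the characteristic function \<open>exp (T powr \<delta> * \<psi> (T powr (- \<delta> / 2) * u))\<close>, where \<open>\<psi>\<close> is the
  distinguished logarithm of the characteristic function of \<open>X 1\<close>. As \<open>T\<close> tends to \<open>0\<close>, it converges:
  for \<open>\<delta> < 0\<close> to a centred Gaussian one with the variance of \<open>X 1\<close> (a central limit theorem), for
  \<open>\<delta> > 0\<close> to a centred Gaussian one with the variance of the Gaussian component of \<open>X 1\<close>, and for
  \<open>\<delta> = 0\<close> it does not depend on \<open>T\<close>. In all cases the limit is continuous at \<open>0\<close> and vanishes at
  infinity, so \<open>Y T\<close> is tight and does not concentrate near \<open>0\<close>: the increment is of exact order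
  \<open>T powr H\<close>. For \<open>h\<close> strictly between \<open>H1\<close> and \<open>H2\<close>, the events \<open>\<bar>f (a + T) - f a\<bar> > T powr h\<close>
  therefore have limiting probability \<open>1\<close> under one law and \<open>0\<close> under the other, and Borel--Cantelli
  along a subsequence of \<open>T\<close> yields a separating set.
\<close>

section \<open>The Levy--Khintchine exponent and continuous logarithms\<close>

definition lk_kernel :: "real \<Rightarrow> real \<Rightarrow> complex" where
  "lk_kernel u x = iexp (u * x) - 1 - \<i> * complex_of_real (u * x * indicator {-1..1} x)"

text \<open>On \<open>[-1, 1]\<close> the kernel is the Taylor remainder of \<open>iexp\<close>
  after the linear term; elsewhere the compensator vanishes and the norm is at most 2. The
  right-hand side is integrable for every Levy measure, and its growth in \<open>u\<close> is only
  quadratic, which is what the rescaling in \<open>lk_exponent_scaled_limit\<close> can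
  absorb.\<close>

lemma norm_lk_kernel_le: "norm (lk_kernel u x) \<le> (2 + u\<^sup>2) * min 1 (x\<^sup>2)"
proof (cases "x \<in> {-1..1}")
  case True
  then have x2: "x\<^sup>2 \<le> 1"
    by (simp add: abs_le_iff abs_square_le_1)
  have "lk_kernel u x = iexp (u * x) - (\<Sum>k\<le>1. (\<i> * (u * x)) ^ k / fact k)"
    using True by (simp add: lk_kernel_def)
  then have "norm (lk_kernel u x) \<le> \<bar>u * x\<bar> ^ 2 / 2"
    using iexp_approx1[of "u * x" 1] by (simp add: numeral_2_eq_2)
  also have "\<dots> = u\<^sup>2 / 2 * x\<^sup>2"
    by (simp add: power_mult_distrib)
  also have "\<dots> \<le> (2 + u\<^sup>2) * x\<^sup>2"
    by (intro mult_right_mono) auto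
  finally show ?thesis
    using x2 by simp
next
  case False
  then have "1 \<le> x\<^sup>2"
    using abs_square_le_1[of x] by (auto simp: abs_le_iff)
  moreover have "norm (lk_kernel u x) \<le> norm (iexp (u * x)) + norm (1::complex)"
    using False norm_triangle_ineq4[of "iexp (u * x)" 1] by (simp add: lk_kernel_def)
  then have "norm (lk_kernel u x) \<le> 2"
    by simp
  ultimately show ?thesis
    by (simp add: min_absorb1 add_increasing2)
qed

lemma borel_measurable_lk_kernel [measurable]: "lk_kernel u \<in> borel_measurable borel"
  unfolding lk_kernel_def by measurable

definition lk_exponent :: "real \<Rightarrow> real \<Rightarrow> real measure \<Rightarrow> real \<Rightarrow> complex" where
  "lk_exponent b v \<Lambda> u =
     \<i> * complex_of_real (b * u) - complex_of_real (v * u\<^sup>2 / 2) + (CLINT x|\<Lambda>. lk_kernel u x)"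

context
  fixes \<Lambda> :: "real measure"
  assumes levy: "levy_measure \<Lambda>"
begin

lemma sets_levy: "sets \<Lambda> = sets borel"
  using levy by (simp add: levy_measure_def)

lemma integrable_min_square:
  notes [measurable_cong] = sets_levy
  shows "integrable \<Lambda> (\<lambda>x. min 1 (x\<^sup>2))"
  using levy by (auto simp: levy_measure_def integrable_iff_bounded)

lemma integrable_lk_kernel:
  notes [measurable_cong] = sets_levy
  shows "integrable \<Lambda> (lk_kernel u)"
  by (rule Bochner_Integration.integrable_bound[OF integrable_mult_right[OF integrable_min_square, of "2 + u\<^sup>2"]])
     (auto intro!: AE_I2 order_trans[OF norm_lk_kernel_le])

text \<open>Dominated convergence along sequences: a convergent sequence of arguments is bounded by
  some \<open>B\<close>, and the bound on the kernel with \<open>B\<close> in place of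
  \<open>u\<close> is independent of the index.\<close>

lemma continuous_lk_exponent:
  notes [measurable_cong] = sets_levy
  shows "continuous_on UNIV (lk_exponent b v \<Lambda>)"
proof -
  have "isCont (\<lambda>u. CLINT x|\<Lambda>. lk_kernel u x) u0" for u0
    unfolding continuous_at_sequentially
  proof (intro allI impI)
    fix f :: "nat \<Rightarrow> real"
    assume f: "f \<longlonglongrightarrow> u0"
    then obtain B where B: "\<And>n. norm (f n) \<le> B"
      using Bseq_def convergent_imp_Bseq convergentI by metis
    have "(\<lambda>n. CLINT x|\<Lambda>. lk_kernel (f n) x) \<longlonglongrightarrow> (CLINT x|\<Lambda>. lk_kernel u0 x)"
    proof (rule integral_dominated_convergence[where w = "\<lambda>x. (2 + B\<^sup>2) * min 1 (x\<^sup>2)"])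
      show "integrable \<Lambda> (\<lambda>x. (2 + B\<^sup>2) * min 1 (x\<^sup>2))"
        using integrable_min_square by simp
      show "AE x in \<Lambda>. (\<lambda>n. lk_kernel (f n) x) \<longlonglongrightarrow> lk_kernel u0 x"
        unfolding lk_kernel_def by (intro AE_I2 tendsto_intros f)
      show "AE x in \<Lambda>. norm (lk_kernel (f n) x) \<le> (2 + B\<^sup>2) * min 1 (x\<^sup>2)" for n
      proof (intro AE_I2 order_trans[OF norm_lk_kernel_le] mult_right_mono add_left_mono)
        show "(f n)\<^sup>2 \<le> B\<^sup>2"
          using B[of n] by (intro abs_le_square_iff[THEN iffD1]) auto
      qed auto
    qed measurable
    then show "((\<lambda>u. CLINT x|\<Lambda>. lk_kernel u x) \<circ> f) \<longlonglongrightarrow> (CLINT x|\<Lambda>. lk_kernel u0 x)"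
      by (simp add: o_def)
  qed
  then show ?thesis
    unfolding lk_exponent_def
    by (intro continuous_intros continuous_at_imp_continuous_on) auto
qed

lemma lk_exponent_0: "lk_exponent b v \<Lambda> 0 = 0"
  by (simp add: lk_exponent_def lk_kernel_def)

text \<open>The real part of the kernel is a cosine minus 1, so the jumps can only decrease the
  modulus of the characteristic function. This gives its decay at infinity when \<delta> =
  0.\<close>

lemma Re_lk_exponent_le: "Re (lk_exponent b v \<Lambda> u) \<le> - v * u\<^sup>2 / 2"
proof -
  have "Re (CLINT x|\<Lambda>. lk_kernel u x) = (LINT x|\<Lambda>. Re (lk_kernel u x))"
    using integrable_lk_kernel by (rule integral_Re[symmetric])
  moreover have "0 \<le> (LINT x|\<Lambda>. - Re (lk_kernel u x))"
    by (intro Bochner_Integration.integral_nonneg_AE AE_I2) (simp add: lk_kernel_def Re_exp)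
  ultimately have "Re (CLINT x|\<Lambda>. lk_kernel u x) \<le> 0"
    by simp
  then show ?thesis
    by (simp add: lk_exponent_def)
qed

text \<open>Only the Gaussian part of the exponent has full quadratic growth. After scaling, the
  drift keeps a factor \<open>s n\<close>, the kernel is pointwise at most
  \<open>2 * (s n)\<^sup>2 + s n * \<bar>u * x\<bar>\<close>, and \<open>norm_lk_kernel_le\<close>
  together with \<open>s n\<close> \<le> 1 supplies a dominating function free of
  \<open>n\<close>.\<close>

lemma lk_exponent_scaled_limit:
  fixes s :: "nat \<Rightarrow> real"
  notes [measurable_cong] = sets_levy
  assumes s: "s \<longlonglongrightarrow> 0" "\<And>n. 0 < s n" "\<And>n. s n \<le> 1"
  shows "(\<lambda>n. complex_of_real ((s n)\<^sup>2) * lk_exponent b v \<Lambda> (u / s n)) \<longlonglongrightarrow> complex_of_real (- v * u\<^sup>2 / 2)"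
proof -
  have "(\<lambda>n. CLINT x|\<Lambda>. complex_of_real ((s n)\<^sup>2) * lk_kernel (u / s n) x) \<longlonglongrightarrow> (CLINT x|\<Lambda>. 0)"
  proof (rule integral_dominated_convergence[where w = "\<lambda>x. (2 + u\<^sup>2) * min 1 (x\<^sup>2)"])
    show "integrable \<Lambda> (\<lambda>x. (2 + u\<^sup>2) * min 1 (x\<^sup>2))"
      using integrable_min_square by simp
    show "AE x in \<Lambda>. (\<lambda>n. complex_of_real ((s n)\<^sup>2) * lk_kernel (u / s n) x) \<longlonglongrightarrow> 0"
    proof (rule AE_I2)
      fix x
      have "norm (complex_of_real ((s n)\<^sup>2) * lk_kernel (u / s n) x) \<le> 2 * (s n)\<^sup>2 + s n * \<bar>u * x\<bar>" for n
      proof -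
        have "norm (lk_kernel (u / s n) x) \<le> norm (iexp (u / s n * x) - 1) +
            norm (\<i> * complex_of_real (u / s n * x * indicator {-1..1} x))"
          unfolding lk_kernel_def by (rule norm_triangle_ineq4)
        also have "norm (iexp (u / s n * x) - 1) \<le> 2"
          using norm_triangle_ineq4[of "iexp (u / s n * x)" 1] by simp
        also have "norm (\<i> * complex_of_real (u / s n * x * indicator {-1..1} x)) \<le> \<bar>u * x\<bar> / s n"
          using s(2)[of n] by (simp add: norm_mult norm_divide abs_mult indicator_def)
        finally have "(s n)\<^sup>2 * norm (lk_kernel (u / s n) x) \<le> (s n)\<^sup>2 * (2 + \<bar>u * x\<bar> / s n)"
          by (intro mult_left_mono) auto
        also have "\<dots> = 2 * (s n)\<^sup>2 + s n * \<bar>u * x\<bar>"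
          using s(2)[of n] by (simp add: field_simps power2_eq_square)
        finally show ?thesis
          by (simp add: norm_mult norm_power)
      qed
      moreover have "(\<lambda>n. 2 * (s n)\<^sup>2 + s n * \<bar>u * x\<bar>) \<longlonglongrightarrow> 2 * 0\<^sup>2 + 0 * \<bar>u * x\<bar>"
        by (intro tendsto_intros s)
      ultimately show "(\<lambda>n. complex_of_real ((s n)\<^sup>2) * lk_kernel (u / s n) x) \<longlonglongrightarrow> 0"
        using Lim_null_comparison[of "\<lambda>n. complex_of_real ((s n)\<^sup>2) * lk_kernel (u / s n) x"
            "\<lambda>n. 2 * (s n)\<^sup>2 + s n * \<bar>u * x\<bar>" sequentially]
        by simp
    qed
    show "AE x in \<Lambda>. norm (complex_of_real ((s n)\<^sup>2) * lk_kernel (u / s n) x) \<le> (2 + u\<^sup>2) * min 1 (x\<^sup>2)" for n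
    proof (intro AE_I2)
      fix x
      have "norm (complex_of_real ((s n)\<^sup>2) * lk_kernel (u / s n) x)
          \<le> (s n)\<^sup>2 * ((2 + (u / s n)\<^sup>2) * min 1 (x\<^sup>2))"
        using norm_lk_kernel_le[of "u / s n" x] by (simp add: norm_mult norm_power mult_left_mono)
      also have "\<dots> = (2 * (s n)\<^sup>2 + u\<^sup>2) * min 1 (x\<^sup>2)"
        using s(2)[of n] by (simp add: field_simps power_divide)
      also have "\<dots> \<le> (2 + u\<^sup>2) * min 1 (x\<^sup>2)"
        using s(2)[of n] s(3)[of n] by (intro mult_right_mono) (auto simp: power_le_one)
      finally show "norm (complex_of_real ((s n)\<^sup>2) * lk_kernel (u / s n) x) \<le> (2 + u\<^sup>2) * min 1 (x\<^sup>2)" .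
    qed
  qed measurable
  then have kernel: "(\<lambda>n. complex_of_real ((s n)\<^sup>2) * (CLINT x|\<Lambda>. lk_kernel (u / s n) x)) \<longlonglongrightarrow> 0"
    by simp
  have "(\<lambda>n. \<i> * complex_of_real (b * u * s n) - complex_of_real (v * u\<^sup>2 / 2)
      + complex_of_real ((s n)\<^sup>2) * (CLINT x|\<Lambda>. lk_kernel (u / s n) x)) \<longlonglongrightarrow>
      \<i> * complex_of_real (b * u * 0) - complex_of_real (v * u\<^sup>2 / 2) + 0"
    by (intro tendsto_intros kernel s)
  moreover have "complex_of_real ((s n)\<^sup>2) * lk_exponent b v \<Lambda> (u / s n) =
      \<i> * complex_of_real (b * u * s n) - complex_of_real (v * u\<^sup>2 / 2)
      + complex_of_real ((s n)\<^sup>2) * (CLINT x|\<Lambda>. lk_kernel (u / s n) x)" for n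
  proof -
    have "(s n)\<^sup>2 * (b * (u / s n)) = b * u * s n" "(s n)\<^sup>2 * (v * (u / s n)\<^sup>2 / 2) = v * u\<^sup>2 / 2"
      using s(2)[of n] by (simp_all add: power2_eq_square)
    then show ?thesis
      unfolding lk_exponent_def distrib_left right_diff_distrib mult.left_commute[of _ \<i>]
      by (metis of_real_mult)
  qed
  moreover have "\<i> * complex_of_real (b * u * 0) - complex_of_real (v * u\<^sup>2 / 2) + 0
      = complex_of_real (- v * u\<^sup>2 / 2)"
    by simp
  ultimately show ?thesis
    by (simp only:)
qed

end

section \<open>Continuous logarithms on the real line\<close>

lemma continuous_logarithm_unique:
  fixes p q :: "real \<Rightarrow> complex"
  assumes "continuous_on UNIV p" "continuous_on UNIV q" "p 0 = q 0" "\<And>u. exp (p u) = exp (q u)"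
  shows "p = q"
proof -
  define d where "d u = (p u - q u) / (2 * of_real pi * \<i>)" for u
  have int: "d u \<in> \<int>" for u
  proof -
    obtain n :: int where "p u = q u + (of_int (2 * n) * of_real pi) * \<i>"
      using assms(4)[of u] by (auto simp: exp_eq)
    then have "d u = of_int n"
      by (simp add: d_def)
    then show ?thesis
      by simp
  qed
  have cont: "continuous_on UNIV d"
    unfolding d_def by (intro continuous_intros assms) auto
  have "d constant_on UNIV"
  proof (rule continuous_discrete_range_constant[OF connected_UNIV cont])
    fix x :: real
    show "\<exists>e>0. \<forall>y. y \<in> UNIV \<and> d y \<noteq> d x \<longrightarrow> e \<le> norm (d y - d x)"
    proof (intro exI[of _ 1] conjI allI impI)
      fix y assume "y \<in> UNIV \<and> d y \<noteq> d x"
      moreover obtain m n where "d y = of_int m" "d x = of_int n"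
        using int by (metis Ints_cases)
      ultimately show "1 \<le> norm (d y - d x)"
        by (simp flip: of_int_diff)
    qed simp
  qed
  then have "d u = d 0" for u
    by (auto simp: constant_on_def)
  then show ?thesis
    using assms(3) by (auto simp: d_def fun_eq_iff)
qed

text \<open>Near 0, \<open>exp z - 1\<close> behaves like \<open>z\<close>. The Caratheodory form of
  the derivative turns this into an exact factorisation of \<open>\<phi> u - 1\<close> as
  \<open>g (p u) * p u\<close> with \<open>g (p u)\<close> tending to 1, so that zeros of
  \<open>p\<close> cause no trouble.\<close>

lemma exp_logarithm_quadratic_limit:
  fixes p \<phi> :: "real \<Rightarrow> complex"
  assumes "isCont p 0" "p 0 = 0" and exp: "\<And>u. \<phi> u = exp (p u)"
    and lim: "((\<lambda>u. (\<phi> u - 1) / of_real (u\<^sup>2)) \<longlongrightarrow> l) (at 0)"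
  shows "((\<lambda>u. p u / of_real (u\<^sup>2)) \<longlongrightarrow> l) (at 0)"
proof -
  obtain g :: "complex \<Rightarrow> complex"
    where g: "\<And>z. exp z - exp 0 = g z * (z - 0)" "isCont g 0" "g 0 = 1"
    using DERIV_exp[of "0::complex"] unfolding CARAT_DERIV by auto
  have "isCont (\<lambda>u. g (p u)) 0"
    using isCont_o2[of 0 p g] assms(1,2) g(2) by simp
  then have gp: "((\<lambda>u. g (p u)) \<longlongrightarrow> 1) (at 0)"
    using assms(2) g(3) by (simp add: isCont_def)
  then have ev: "\<forall>\<^sub>F u in at 0. g (p u) \<noteq> 0"
    by (rule tendsto_imp_eventually_ne) simp
  have "((\<lambda>u. (\<phi> u - 1) / of_real (u\<^sup>2) / g (p u)) \<longlongrightarrow> l / 1) (at 0)"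
    by (intro tendsto_divide lim gp) simp
  moreover have "\<forall>\<^sub>F u in at 0. (\<phi> u - 1) / of_real (u\<^sup>2) / g (p u) = p u / of_real (u\<^sup>2)"
    using ev
  proof eventually_elim
    case (elim u)
    have "\<phi> u - 1 = g (p u) * p u"
      using g(1)[of "p u"] exp[of u] by simp
    then show ?case
      using elim by simp
  qed
  ultimately show ?thesis
    by (simp add: filterlim_cong)
qed

section \<open>Concentration from limits of characteristic functions\<close>

text \<open>The integrand on the left is the standard normal characteristic function at
  \<open>r * y\<close>, and Fubini exchanges the roles of the two laws. Pointwise limits of
  characteristic functions thus pass to these expectations by dominated convergence.\<close>

lemma (in real_distribution) gaussian_smoothing:
  "complex_of_real (expectation (\<lambda>y. exp (- (r * y)\<^sup>2 / 2)))
     = (CLINT x|std_normal_distribution. char M (r * x))"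
proof -
  interpret N: real_distribution std_normal_distribution
    by (rule real_dist_normal_dist)
  interpret P: pair_sigma_finite M std_normal_distribution ..
  interpret PP: prob_space "M \<Otimes>\<^sub>M std_normal_distribution"
    by (rule prob_space_pair) unfold_locales
  have "integrable (M \<Otimes>\<^sub>M std_normal_distribution) (\<lambda>(y, x). iexp (r * x * y))"
    by (rule PP.integrable_const_bound[where B = 1]) (auto simp: case_prod_beta)
  then have "(CLINT x|std_normal_distribution. CLINT y|M. iexp (r * x * y))
      = (CLINT y|M. CLINT x|std_normal_distribution. iexp (r * x * y))"
    by (rule P.Fubini_integral)
  also have "\<dots> = (CLINT y|M. char std_normal_distribution (r * y))"
    by (simp add: char_def mult.assoc mult.commute mult.left_commute)
  also have "\<dots> = complex_of_real (expectation (\<lambda>y. exp (- (r * y)\<^sup>2 / 2)))"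
    unfolding char_std_normal_distribution by (rule integral_complex_of_real)
  finally show ?thesis
    by (simp add: char_def)
qed

locale char_limit =
  fixes \<nu> :: "nat \<Rightarrow> real measure" and g :: "real \<Rightarrow> complex"
  assumes distribution: "\<And>n. real_distribution (\<nu> n)"
    and char_tendsto: "\<And>u. (\<lambda>n. char (\<nu> n) u) \<longlonglongrightarrow> g u"
begin

text \<open>
  By Gaussian smoothing this is the limit of the expectations of \<open>exp (- (r * y)\<^sup>2 / 2)\<close> under \<open>\<nu> n\<close>,
  which control the mass near \<open>0\<close> for large \<open>r\<close> and the mass near infinity for small \<open>r\<close>.
\<close>

definition smoothed :: "real \<Rightarrow> complex" where
  "smoothed r = (CLINT x|std_normal_distribution. g (r * x))"

lemma norm_limit_le: "norm (g u) \<le> 1"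
  using char_tendsto[of u] distribution
  by (intro tendsto_upperbound[of "\<lambda>n. norm (char (\<nu> n) u)" _ sequentially])
     (auto intro!: tendsto_norm always_eventually real_distribution.cmod_char_le_1)

lemma borel_measurable_limit [measurable]: "g \<in> borel_measurable borel"
proof (rule borel_measurable_LIMSEQ_metric)
  show "char (\<nu> n) \<in> borel_measurable borel" for n
  proof -
    interpret real_distribution "\<nu> n" by (rule distribution)
    show ?thesis by measurable
  qed
qed (rule char_tendsto)

lemma smoothed_tendsto:
  "(\<lambda>n. complex_of_real (LINT y|\<nu> n. exp (- (r * y)\<^sup>2 / 2))) \<longlonglongrightarrow> smoothed r"
proof -
  interpret N: real_distribution std_normal_distribution
    by (rule real_dist_normal_dist)
  have [measurable]: "char (\<nu> n) \<in> borel_measurable borel" for n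
  proof -
    interpret real_distribution "\<nu> n" by (rule distribution)
    show ?thesis by measurable
  qed
  have "(\<lambda>n. CLINT x|std_normal_distribution. char (\<nu> n) (r * x)) \<longlonglongrightarrow> smoothed r"
    unfolding smoothed_def
  proof (rule integral_dominated_convergence[where w = "\<lambda>_. 1"])
    show "AE x in std_normal_distribution. norm (char (\<nu> n) (r * x)) \<le> 1" for n
      using real_distribution.cmod_char_le_1[OF distribution] by simp
  qed (auto intro: char_tendsto)
  then show ?thesis
    using real_distribution.gaussian_smoothing[OF distribution] by simp
qed

lemma smoothed_at_0:
  assumes "isCont g 0" "g 0 = 1"
  shows "(\<lambda>k. smoothed (1 / real (Suc k))) \<longlonglongrightarrow> 1"
proof -
  interpret N: real_distribution std_normal_distribution
    by (rule real_dist_normal_dist)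
  have "(\<lambda>k. CLINT x|std_normal_distribution. g (1 / real (Suc k) * x)) \<longlonglongrightarrow>
      (CLINT x|std_normal_distribution. 1)"
  proof (rule integral_dominated_convergence[where w = "\<lambda>_. 1"])
    show "AE x in std_normal_distribution. (\<lambda>k. g (1 / real (Suc k) * x)) \<longlonglongrightarrow> 1"
    proof (rule AE_I2)
      fix x :: real
      have "(\<lambda>k. 1 / real (Suc k) * x) \<longlonglongrightarrow> 0 * x"
        by (intro tendsto_intros LIMSEQ_Suc lim_1_over_n)
      then show "(\<lambda>k. g (1 / real (Suc k) * x)) \<longlonglongrightarrow> 1"
        using isCont_tendsto_compose[OF assms(1)] assms(2) by simp
    qed
  qed (auto intro: norm_limit_le)
  moreover have "(CLINT x|std_normal_distribution. 1) = (1::complex)"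
    using N.prob_space by simp
  ultimately show ?thesis
    by (simp add: smoothed_def)
qed

lemma smoothed_at_infinity:
  assumes "(g \<longlongrightarrow> 0) at_infinity"
  shows "(\<lambda>k. smoothed (real (Suc k))) \<longlonglongrightarrow> 0"
proof -
  interpret N: real_distribution std_normal_distribution
    by (rule real_dist_normal_dist)
  \<comment> \<open>At \<open>x = 0\<close> the argument \<open>real (Suc k) * x\<close> does not
    leave 0, so this single point has to be discarded as a null set of the normal law.\<close>
  have "AE x in lborel. x \<noteq> (0::real)"
    by (rule AE_lborel_singleton)
  then have nz: "AE x in std_normal_distribution. x \<noteq> 0"
    by (subst AE_density) auto
  have "(\<lambda>k. CLINT x|std_normal_distribution. g (real (Suc k) * x)) \<longlonglongrightarrow>
      (CLINT x|std_normal_distribution. 0)"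
  proof (rule integral_dominated_convergence[where w = "\<lambda>_. 1"])
    show "AE x in std_normal_distribution. (\<lambda>k. g (real (Suc k) * x)) \<longlonglongrightarrow> 0"
      using nz
    proof eventually_elim
      case (elim x)
      have "filterlim (\<lambda>k. \<bar>x\<bar> * real (Suc k)) at_top sequentially"
        by (rule filterlim_tendsto_pos_mult_at_top[OF tendsto_const _
              filterlim_compose[OF filterlim_real_sequentially filterlim_Suc]])
           (use elim in simp)
      then have "filterlim (\<lambda>k. real (Suc k) * x) at_infinity sequentially"
        by (intro filterlim_norm_at_top_imp_at_infinity) (simp add: abs_mult mult.commute del: of_nat_Suc)
      then show ?case
        by (rule filterlim_compose[OF assms])
    qed
  qed (auto intro: norm_limit_le)
  then show ?thesis
    by (simp add: smoothed_def)
qed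

text \<open>A Markov-type bound: for \<open>R * \<bar>y\<bar>\<close> \<le> 1 the Gaussian weight is
  at least \<open>exp (- 1 / 2)\<close>, hence at least 1/2, so the mass near 0 is at most twice the
  smoothed expectation. First a large \<open>R\<close> is fixed, then \<open>n\<close> is taken so
  large that \<open>r n < 1 / R\<close>.\<close>

lemma no_mass_near_0:
  assumes g: "(g \<longlongrightarrow> 0) at_infinity" and r: "r \<longlonglongrightarrow> 0"
  shows "(\<lambda>n. measure (\<nu> n) {y. \<bar>y\<bar> \<le> r n}) \<longlonglongrightarrow> 0"
proof (rule LIMSEQ_I)
  fix e :: real assume "0 < e"
  then obtain k where k: "norm (smoothed (real (Suc k))) < e / 2"
    using LIMSEQ_D[OF smoothed_at_infinity[OF g], of "e / 2"] by auto
  define R where "R = real (Suc k)"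
  have R: "0 < R"
    by (simp add: R_def)
  have "\<forall>\<^sub>F n in sequentially. norm (complex_of_real (LINT y|\<nu> n. exp (- (R * y)\<^sup>2 / 2))) < e / 2"
    using tendsto_norm[OF smoothed_tendsto[of R]] k unfolding R_def by (rule order_tendstoD)
  moreover have "\<forall>\<^sub>F n in sequentially. r n < 1 / R"
    using r R by (intro order_tendstoD[of r 0]) auto
  ultimately have "\<forall>\<^sub>F n in sequentially. norm (measure (\<nu> n) {y. \<bar>y\<bar> \<le> r n} - 0) < e"
  proof eventually_elim
    case (elim n)
    interpret real_distribution "\<nu> n" by (rule distribution)
    have "measure (\<nu> n) {y. \<bar>y\<bar> \<le> r n} = (LINT y|\<nu> n. indicator {y. \<bar>y\<bar> \<le> r n} y)"
      by simp
    also have "\<dots> \<le> (LINT y|\<nu> n. 2 * exp (- (R * y)\<^sup>2 / 2))"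
    proof (rule integral_mono)
      show "integrable (\<nu> n) (\<lambda>y. 2 * exp (- (R * y)\<^sup>2 / 2))"
        by (rule integrable_const_bound[where B = 2]) auto
      show "indicator {y. \<bar>y\<bar> \<le> r n} y \<le> 2 * exp (- (R * y)\<^sup>2 / 2)" for y :: real
      proof (cases "\<bar>y\<bar> \<le> r n")
        case True
        then have "R * \<bar>y\<bar> \<le> R * r n"
          using R by (intro mult_left_mono) auto
        also have "\<dots> \<le> 1"
          using elim(2) R by (simp add: field_simps)
        finally have "R * \<bar>y\<bar> \<le> 1" .
        then have "(R * y)\<^sup>2 \<le> 1"
          using R by (simp add: abs_mult abs_square_le_1)
        then have "exp (- 1 / 2) \<le> exp (- (R * y)\<^sup>2 / 2)"
          by simp
        moreover have "1 \<le> 2 * exp (- 1 / 2 :: real)"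
          using exp_half_le2 by (simp add: exp_minus field_simps)
        ultimately have "1 \<le> 2 * exp (- (R * y)\<^sup>2 / 2)"
          by linarith
        then show ?thesis
          using True by simp
      qed simp
    qed (simp add: integrable_real_indicator less_top[symmetric])
    also have "\<dots> = 2 * (LINT y|\<nu> n. exp (- (R * y)\<^sup>2 / 2))"
      by simp
    also have "\<dots> < e"
      using elim(1) by simp
    finally show ?case
      by simp
  qed
  then show "\<exists>no. \<forall>n\<ge>no. norm (measure (\<nu> n) {y. \<bar>y\<bar> \<le> r n} - 0) < e"
    by (simp add: eventually_sequentially)
qed

text \<open>Dually, for \<open>R * \<bar>y\<bar>\<close> \<ge> 1 the Gaussian weight is at most 2/3,
  so the mass far out is at most three times the defect of the smoothed expectation from 1. Here
  \<open>R\<close> is taken small.\<close>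

lemma no_mass_at_infinity:
  assumes g: "isCont g 0" "g 0 = 1" and r: "filterlim r at_top sequentially"
  shows "(\<lambda>n. measure (\<nu> n) {y. r n < \<bar>y\<bar>}) \<longlonglongrightarrow> 0"
proof (rule LIMSEQ_I)
  fix e :: real assume "0 < e"
  then obtain k where k: "norm (smoothed (1 / real (Suc k)) - 1) < e / 3"
    using LIMSEQ_D[OF smoothed_at_0[OF g], of "e / 3"] by auto
  define R where "R = 1 / real (Suc k)"
  have R: "0 < R"
    by (simp add: R_def)
  have "(\<lambda>n. complex_of_real (LINT y|\<nu> n. exp (- (R * y)\<^sup>2 / 2)) - 1) \<longlonglongrightarrow> smoothed R - 1"
    by (intro tendsto_intros smoothed_tendsto)
  then have "\<forall>\<^sub>F n in sequentially. norm (complex_of_real (LINT y|\<nu> n. exp (- (R * y)\<^sup>2 / 2)) - 1) < e / 3"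
    using k unfolding R_def by (intro order_tendstoD(2)[OF tendsto_norm]) auto
  moreover have "\<forall>\<^sub>F n in sequentially. 1 / R \<le> r n"
    using r by (simp add: filterlim_at_top)
  ultimately have "\<forall>\<^sub>F n in sequentially. norm (measure (\<nu> n) {y. r n < \<bar>y\<bar>} - 0) < e"
  proof eventually_elim
    case (elim n)
    interpret real_distribution "\<nu> n" by (rule distribution)
    have int: "integrable (\<nu> n) (\<lambda>y. exp (- (R * y)\<^sup>2 / 2))"
      by (rule integrable_const_bound[where B = 1]) auto
    have "measure (\<nu> n) {y. r n < \<bar>y\<bar>} = (LINT y|\<nu> n. indicator {y. r n < \<bar>y\<bar>} y)"
      by simp
    also have "\<dots> \<le> (LINT y|\<nu> n. 3 * (1 - exp (- (R * y)\<^sup>2 / 2)))"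
    proof (rule integral_mono)
      show "integrable (\<nu> n) (\<lambda>y. 3 * (1 - exp (- (R * y)\<^sup>2 / 2)))"
        using int by simp
      show "indicator {y. r n < \<bar>y\<bar>} y \<le> 3 * (1 - exp (- (R * y)\<^sup>2 / 2))" for y :: real
      proof (cases "r n < \<bar>y\<bar>")
        case True
        then have "R * r n \<le> R * \<bar>y\<bar>"
          using R by (intro mult_left_mono) auto
        moreover have "1 \<le> R * r n"
          using elim(2) R by (simp add: field_simps)
        ultimately have "1 \<le> R * \<bar>y\<bar>"
          by linarith
        then have "1 \<le> (R * y)\<^sup>2"
          using R abs_square_less_1[of "R * y"] by (simp add: abs_mult)
        then have "exp (- (R * y)\<^sup>2 / 2) \<le> exp (- 1 / 2)"
          by simp
        also have "exp (- 1 / 2 :: real) \<le> 2 / 3"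
          using exp_ge_add_one_self[of "1 / 2 :: real"] by (simp add: exp_minus field_simps)
        finally show ?thesis
          using True by simp
      qed simp
    qed (simp add: integrable_real_indicator less_top[symmetric])
    also have "\<dots> = 3 * (1 - (LINT y|\<nu> n. exp (- (R * y)\<^sup>2 / 2)))"
      using int prob_space by simp
    also have "\<dots> < e"
    proof -
      have norm_eq: "norm (complex_of_real z - 1) = \<bar>z - 1\<bar>" for z
        by (metis norm_of_real of_real_1 of_real_diff)
      have "\<bar>z - 1\<bar> < e / 3 \<Longrightarrow> 3 * (1 - z) < e" for z :: real
        by (cases "z \<le> 1") auto
      from this[OF elim(1)[unfolded norm_eq]] show ?thesis .
    qed
    finally show ?case
      by simp
  qed
  then show "\<exists>no. \<forall>n\<ge>no. norm (measure (\<nu> n) {y. r n < \<bar>y\<bar>} - 0) < e"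
    by (simp add: eventually_sequentially)
qed

end

section \<open>Small increments of dilatively stable processes\<close>

lemma distr_fdd_singleton:
  assumes "X t \<in> borel_measurable M"
  shows "distr (fdd M X {t}) borel (\<lambda>x. x t) = distr M borel (X t)"
  unfolding fdd_def using assms by (subst distr_distr) (auto simp: comp_def intro: measurable_restrict)

lemma fdd_singleton_cong:
  assumes "fdd M X {t} = fdd N Y {t}" "X t \<in> borel_measurable M" "Y t \<in> borel_measurable N"
  shows "distr M borel (X t) = distr N borel (Y t)"
  using assms distr_fdd_singleton by metis

lemma char_fun_fdd_singleton:
  assumes "X t \<in> borel_measurable M"
  shows "char_fun {t} (fdd M X {t}) (\<lambda>j\<in>{t}. u) = char (distr M borel (X t)) u"
proof -
  have "char (distr M borel (X t)) u = (CLINT x|fdd M X {t}. iexp (u * x t))"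
    unfolding distr_fdd_singleton[of X t M, OF assms, symmetric] char_def
    by (rule integral_distr) (auto simp: fdd_def cong: measurable_cong_sets)
  then show ?thesis
    by (simp add: char_fun_def)
qed

lemma char_distr_scale:
  assumes "Z \<in> borel_measurable M"
  shows "char (distr M borel (\<lambda>\<omega>. c * Z \<omega>)) u = char (distr M borel Z) (c * u)"
  using assms by (simp add: char_def integral_distr mult.assoc mult.left_commute)

text \<open>The scaling relation is read at time 1 only: \<open>X T\<close> has the law of
  \<open>T powr (H - \<delta> / 2) * Y 1\<close>, and the characteristic function of
  \<open>Y 1\<close> is a power of that of \<open>X 1\<close>. A priori \<open>p\<close> depends on
  \<open>T\<close>, because the logarithm is chosen separately for each convolution power.\<close>

lemma dilatively_stable_logarithm:
  assumes "dilatively_stable H \<delta> M X" "0 < T"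
  obtains p where "continuous_on UNIV p" "p 0 = 0"
    "\<And>u. char (distr M borel (X 1)) u = exp (p u)"
    "\<And>u. char (distr M borel (X T)) u =
       exp (complex_of_real (T powr \<delta>) * p (T powr (H - \<delta> / 2) * u))"
proof -
  have X: "X t \<in> borel_measurable M" if "0 \<le> t" for t
    using assms(1) that by (simp add: dilatively_stable_def real_process_def)
  obtain N :: "(real \<Rightarrow> real) measure" and Y
    where Y: "convolution_power_process M X (T powr \<delta>) N Y"
      and same: "same_fdd M (\<lambda>t. X (T * t)) N (\<lambda>t \<omega>. T powr (H - \<delta> / 2) * Y t \<omega>)"
    using assms unfolding dilatively_stable_def by blast
  have Y1 [measurable]: "Y 1 \<in> borel_measurable N"
    using Y by (simp add: convolution_power_process_def real_process_def)
  have "convolution_power {1} (T powr \<delta>) (fdd M X {1}) (fdd N Y {1})"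
    using Y by (simp add: convolution_power_process_def)
  then obtain \<psi> where \<psi>: "continuous_map (powertop_real {1}) euclidean \<psi>" "\<psi> (\<lambda>j\<in>{1}. 0) = 0"
      "\<And>u. u \<in> (\<Pi>\<^sub>E j\<in>{1}. UNIV) \<Longrightarrow> char_fun {1} (fdd M X {1}) u = exp (\<psi> u)"
      "\<And>u. u \<in> (\<Pi>\<^sub>E j\<in>{1}. UNIV) \<Longrightarrow>
         char_fun {1} (fdd N Y {1}) u = exp (complex_of_real (T powr \<delta>) * \<psi> u)"
    unfolding convolution_power_def by blast
  \<comment> \<open>The index set is a singleton, so its power space is a copy of the real line and
    \<psi> becomes a continuous logarithm of a function of one real variable.\<close>
  define p where "p u = \<psi> (\<lambda>j\<in>{1::real}. u)" for u
  have "continuous_map euclideanreal (powertop_real {1}) (\<lambda>u. \<lambda>j\<in>{1::real}. u)"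
    by (auto simp: continuous_map_componentwise)
  from continuous_map_compose[OF this \<psi>(1)] have "continuous_on UNIV p"
    by (simp add: o_def p_def [abs_def])
  moreover have "p 0 = 0"
    using \<psi>(2) by (simp add: p_def)
  moreover have "char (distr M borel (X 1)) u = exp (p u)" for u
    using \<psi>(3)[of "\<lambda>j\<in>{1}. u"] char_fun_fdd_singleton[of X 1 M u] X[of 1] by (simp add: p_def)
  moreover have "char (distr M borel (X T)) u =
      exp (complex_of_real (T powr \<delta>) * p (T powr (H - \<delta> / 2) * u))" for u
  proof -
    have "fdd M (\<lambda>t. X (T * t)) {1} = fdd N (\<lambda>t \<omega>. T powr (H - \<delta> / 2) * Y t \<omega>) {1}"
      using same by (simp add: same_fdd_def)
    then have "distr M borel (X (T * 1)) = distr N borel (\<lambda>\<omega>. T powr (H - \<delta> / 2) * Y 1 \<omega>)"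
      using assms(2) by (intro fdd_singleton_cong[where X = "\<lambda>t. X (T * t)"]) (auto intro: X)
    then show ?thesis
      using \<psi>(4)[of "\<lambda>j\<in>{1}. T powr (H - \<delta> / 2) * u"] char_distr_scale[OF Y1]
        char_fun_fdd_singleton[of Y 1 N "T powr (H - \<delta> / 2) * u", OF Y1]
      by (simp add: p_def)
  qed
  ultimately show ?thesis
    by (rule that)
qed

lemma distr_increment:
  assumes ds: "dilatively_stable H \<delta> M X" and stat: "stationary_increments M X"
    and "0 \<le> a" "0 \<le> T"
  shows "distr M borel (\<lambda>\<omega>. X (a + T) \<omega> - X a \<omega>) = distr M borel (X T)"
proof -
  have X [measurable]: "X t \<in> borel_measurable M" if "0 \<le> t" for t
    using ds that by (simp add: dilatively_stable_def real_process_def)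
  have zero: "AE \<omega> in M. X 0 \<omega> = 0"
    using ds by (simp add: dilatively_stable_def)
  have "fdd M (\<lambda>t \<omega>. X (t + a) \<omega> - X a \<omega>) {T} = fdd M (\<lambda>t \<omega>. X t \<omega> - X 0 \<omega>) {T}"
    using stat assms by (simp add: stationary_increments_def same_fdd_def)
  then have "distr M borel (\<lambda>\<omega>. X (T + a) \<omega> - X a \<omega>) = distr M borel (\<lambda>\<omega>. X T \<omega> - X 0 \<omega>)"
    by (rule fdd_singleton_cong[where X = "\<lambda>t \<omega>. X (t + a) \<omega> - X a \<omega>" and Y = "\<lambda>t \<omega>. X t \<omega> - X 0 \<omega>"])
       (auto intro!: borel_measurable_diff X add_nonneg_nonneg assms(3,4))
  \<comment> \<open>\<open>X 0\<close> vanishes only almost surely, which is enough for equality of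
    laws.\<close>
  also have "\<dots> = distr M borel (X T)"
    using zero assms by (intro distr_cong_AE) (auto intro!: borel_measurable_diff X)
  finally show ?thesis
    by (simp add: add.commute)
qed

section \<open>Limits of the rescaled increments\<close>

lemma gaussian_char_at_infinity:
  fixes v :: real
  assumes "0 < v"
  shows "((\<lambda>u. exp (- v * u\<^sup>2 / 2)) \<longlongrightarrow> 0) (at_infinity :: real filter)"
proof (rule Lim_null_comparison)
  show "\<forall>\<^sub>F u in at_infinity. norm (exp (- v * u\<^sup>2 / 2)) \<le> 2 / v * (inverse u)\<^sup>2"
    unfolding eventually_at_infinity
  proof (intro exI[of _ 1] allI impI)
    fix u :: real assume "1 \<le> norm u"
    then have "0 < v * u\<^sup>2 / 2"
      using assms by auto
    moreover have "v * u\<^sup>2 / 2 \<le> exp (v * u\<^sup>2 / 2)"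
      using exp_ge_add_one_self[of "v * u\<^sup>2 / 2"] by linarith
    ultimately have "inverse (exp (v * u\<^sup>2 / 2)) \<le> inverse (v * u\<^sup>2 / 2)"
      by (rule le_imp_inverse_le[rotated])
    moreover have "inverse (v * u\<^sup>2 / 2) = 2 / v * (inverse u)\<^sup>2"
      by (simp add: field_simps)
    moreover have "norm (exp (- v * u\<^sup>2 / 2)) = inverse (exp (v * u\<^sup>2 / 2))"
      by (simp flip: exp_minus)
    ultimately show "norm (exp (- v * u\<^sup>2 / 2)) \<le> 2 / v * (inverse u)\<^sup>2"
      by (simp only:)
  qed
  have "((\<lambda>u. 2 / v * (inverse u)\<^sup>2) \<longlongrightarrow> 2 / v * 0\<^sup>2) (at_infinity :: real filter)"
    by (intro tendsto_intros tendsto_inverse_0)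
  then show "((\<lambda>u. 2 / v * (inverse u)\<^sup>2) \<longlongrightarrow> 0) (at_infinity :: real filter)"
    by simp
qed

text \<open>A second-order Taylor expansion. Bounding the minimum in the remainder of
  \<open>char_approx3'\<close> by its cubic entry uses the third moment and leaves an error of order
  \<open>\<bar>u\<bar>\<close> after division by \<open>u\<^sup>2\<close>.\<close>

lemma (in prob_space) char_distr_quadratic_limit:
  assumes X [measurable]: "random_variable borel X"
    and moments: "\<And>k. integrable M (\<lambda>\<omega>. \<bar>X \<omega>\<bar> ^ k)" and "expectation X = 0"
  shows "((\<lambda>u. (char (distr M borel X) u - 1) / of_real (u\<^sup>2)) \<longlongrightarrow>
            - complex_of_real (expectation (\<lambda>\<omega>. (X \<omega>)\<^sup>2) / 2)) (at 0)"
proof -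
  define V where "V = expectation (\<lambda>\<omega>. (X \<omega>)\<^sup>2)"
  define C where "C = expectation (\<lambda>\<omega>. \<bar>X \<omega>\<bar> ^ 3)"
  have X1: "integrable M X"
    using moments[of 1] by (simp add: integrable_abs_iff)
  have X2: "integrable M (\<lambda>\<omega>. (X \<omega>)\<^sup>2)"
    using moments[of 2] by simp
  have bound: "norm (char (distr M borel X) u - complex_of_real (1 - u\<^sup>2 * V / 2)) \<le> u\<^sup>2 / 6 * (\<bar>u\<bar> * C)" for u
  proof -
    have "norm (char (distr M borel X) u - complex_of_real (1 - u\<^sup>2 * V / 2)) \<le>
        u\<^sup>2 / 6 * expectation (\<lambda>\<omega>. min (6 * (X \<omega>)\<^sup>2) (\<bar>u\<bar> * \<bar>X \<omega>\<bar> ^ 3))"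
      using char_approx3'[OF X X1 X2 assms(3) _ refl, of V u] assms(3) by (simp add: V_def)
    also have "expectation (\<lambda>\<omega>. min (6 * (X \<omega>)\<^sup>2) (\<bar>u\<bar> * \<bar>X \<omega>\<bar> ^ 3)) \<le> expectation (\<lambda>\<omega>. \<bar>u\<bar> * \<bar>X \<omega>\<bar> ^ 3)"
      using moments[of 3] X2 by (intro integral_mono integrable_min) auto
    also have "\<dots> = \<bar>u\<bar> * C"
      by (simp add: C_def)
    finally show ?thesis
      by (simp add: mult_left_mono)
  qed
  have "((\<lambda>u. (char (distr M borel X) u - 1) / of_real (u\<^sup>2) - - complex_of_real (V / 2)) \<longlongrightarrow> 0) (at 0)"
  proof (rule Lim_null_comparison)
    show "\<forall>\<^sub>F u in at 0. norm ((char (distr M borel X) u - 1) / of_real (u\<^sup>2) - - complex_of_real (V / 2))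
        \<le> \<bar>u\<bar> * C / 6"
      unfolding eventually_at_filter
    proof (intro always_eventually allI impI)
      fix u :: real assume u: "u \<noteq> 0"
      have "(char (distr M borel X) u - 1) / of_real (u\<^sup>2) - - complex_of_real (V / 2) =
          (char (distr M borel X) u - complex_of_real (1 - u\<^sup>2 * V / 2)) / of_real (u\<^sup>2)"
        using u by (simp add: field_simps)
      then have "norm ((char (distr M borel X) u - 1) / of_real (u\<^sup>2) - - complex_of_real (V / 2)) =
          norm (char (distr M borel X) u - complex_of_real (1 - u\<^sup>2 * V / 2)) / u\<^sup>2"
        by (simp add: norm_divide norm_power)
      also have "\<dots> \<le> (u\<^sup>2 / 6 * (\<bar>u\<bar> * C)) / u\<^sup>2"
        by (intro divide_right_mono bound) auto
      also have "\<dots> = \<bar>u\<bar> * C / 6"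
        using u by simp
      finally show "norm ((char (distr M borel X) u - 1) / of_real (u\<^sup>2) - - complex_of_real (V / 2))
          \<le> \<bar>u\<bar> * C / 6" .
    qed
    have "((\<lambda>u. \<bar>u\<bar> * C / 6) \<longlongrightarrow> \<bar>0\<bar> * C / 6) (at (0::real))"
      by (intro tendsto_intros) auto
    then show "((\<lambda>u. \<bar>u\<bar> * C / 6) \<longlongrightarrow> 0) (at (0::real))"
      by simp
  qed
  then show ?thesis
    unfolding V_def by (rule Lim_null[THEN iffD2])
qed

text \<open>A vanishing second moment would make the law a point mass at 0, which
  \<open>gaussian\<close> includes.\<close>

lemma (in prob_space) second_moment_pos:
  assumes X: "random_variable borel X" and "integrable M (\<lambda>\<omega>. (X \<omega>)\<^sup>2)"
    and ng: "\<not> gaussian (distr M borel X)"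
  shows "0 < expectation (\<lambda>\<omega>. (X \<omega>)\<^sup>2)"
proof (rule ccontr)
  assume "\<not> 0 < expectation (\<lambda>\<omega>. (X \<omega>)\<^sup>2)"
  moreover have "0 \<le> expectation (\<lambda>\<omega>. (X \<omega>)\<^sup>2)"
    by simp
  ultimately have "expectation (\<lambda>\<omega>. (X \<omega>)\<^sup>2) = 0"
    by linarith
  then have "AE \<omega> in M. X \<omega> = 0"
    using assms(2) by (subst (asm) integral_nonneg_eq_0_iff_AE) auto
  then have "distr M borel X = distr M borel (\<lambda>_. 0)"
    using X by (intro distr_cong_AE) auto
  then have "distr M borel X = return borel 0"
    by simp
  then show False
    using ng by (auto simp: gaussian_def)
qed

lemma powr_tendsto_0:
  fixes T :: "nat \<Rightarrow> real"
  assumes "T \<longlonglongrightarrow> 0" "\<And>n. 0 < T n" "0 < c"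
  shows "(\<lambda>n. T n powr c) \<longlonglongrightarrow> 0"
  using assms by (intro tendsto_zero_powrI[OF _ tendsto_const]) (auto intro!: always_eventually less_imp_le)

text \<open>All the logarithms obtained for the various \<open>T\<close> belong to the same
  characteristic function, so by uniqueness they coincide with the one for
  \<open>T = 1\<close>.\<close>

lemma dilatively_stable_logarithm_uniform:
  assumes ds: "dilatively_stable H \<delta> M X"
  obtains p where "continuous_on UNIV p" "p 0 = 0"
    "\<And>u. char (distr M borel (X 1)) u = exp (p u)"
    "\<And>T u. 0 < T \<Longrightarrow> char (distr M borel (X T)) u =
       exp (complex_of_real (T powr \<delta>) * p (T powr (H - \<delta> / 2) * u))"
proof -
  obtain p where p: "continuous_on UNIV p" "p 0 = 0"
      "\<And>u. char (distr M borel (X 1)) u = exp (p u)"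
    using dilatively_stable_logarithm[OF ds, of 1] by auto
  have "char (distr M borel (X T)) u =
      exp (complex_of_real (T powr \<delta>) * p (T powr (H - \<delta> / 2) * u))" if T: "0 < T" for T u
  proof -
    obtain q where q: "continuous_on UNIV q" "q 0 = 0"
        "\<And>u. char (distr M borel (X 1)) u = exp (q u)"
        "\<And>u. char (distr M borel (X T)) u =
           exp (complex_of_real (T powr \<delta>) * q (T powr (H - \<delta> / 2) * u))"
      using dilatively_stable_logarithm[OF ds T] by blast
    moreover have "q = p"
      by (rule continuous_logarithm_unique) (use p q in auto)
    ultimately show ?thesis
      by simp
  qed
  with p show ?thesis
    by (rule that)
qed

text \<open>The logarithm of the characteristic function is \<open>E n u\<close>, in which
  \<open>p\<close> is evaluated at \<open>T n powr (- \<delta> / 2) * u\<close>. For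
  \<open>u\<close> nonzero this argument tends to 0, stays fixed or leaves every bounded set
  according to the sign of \<delta>, so the limit is governed by the moments, by \<open>p\<close>
  itself or by the Gaussian component. The properties of \<open>g\<close> are those required by
  \<open>no_mass_near_0\<close> and \<open>no_mass_at_infinity\<close>.\<close>

lemma rescaled_increments_char_limit:
  fixes T :: "nat \<Rightarrow> real"
  assumes ds: "dilatively_stable H \<delta> M X" and stat: "stationary_increments M X"
    and zm: "zero_mean M X"
    and gauss: "\<delta> \<ge> 0 \<longrightarrow> has_gaussian_component (distr M borel (X 1))"
    and a: "0 \<le> a" and T: "T \<longlonglongrightarrow> 0" "\<And>n. 0 < T n" "\<And>n. T n \<le> 1"
  obtains g where
    "char_limit (\<lambda>n. distr M borel (\<lambda>\<omega>. T n powr - H * (X (a + T n) \<omega> - X a \<omega>))) g"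
    "isCont g 0" "g 0 = 1" "(g \<longlongrightarrow> 0) at_infinity"
proof -
  note witness = that
  define \<nu> where "\<nu> n = distr M borel (\<lambda>\<omega>. T n powr - H * (X (a + T n) \<omega> - X a \<omega>))" for n
  interpret prob_space M
    using ds by (simp add: dilatively_stable_def real_process_def)
  have X: "X t \<in> borel_measurable M" if "0 \<le> t" for t
    using ds that by (simp add: dilatively_stable_def real_process_def)
  have incr: "(\<lambda>\<omega>. X (a + T n) \<omega> - X a \<omega>) \<in> borel_measurable M" for n
    using a less_imp_le[OF T(2)] by (intro borel_measurable_diff X) auto
  have real_distr: "real_distribution (\<nu> n)" for n
    unfolding \<nu>_def by (intro real_distribution_distr borel_measurable_times borel_measurable_const incr)
  obtain p where p: "continuous_on UNIV p" "p 0 = 0"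
      "\<And>u. char (distr M borel (X 1)) u = exp (p u)"
      and pT: "\<And>T u. 0 < T \<Longrightarrow> char (distr M borel (X T)) u =
        exp (complex_of_real (T powr \<delta>) * p (T powr (H - \<delta> / 2) * u))"
    using dilatively_stable_logarithm_uniform[OF ds] by blast
  have cont_p: "isCont p 0"
    using p(1) by (simp add: continuous_on_eq_continuous_at)
  define E where "E n u = complex_of_real (T n powr \<delta>) * p (T n powr (- \<delta> / 2) * u)" for n u
  have char_\<nu>: "char (\<nu> n) u = exp (E n u)" for n u
  proof -
    have "T n powr (H - \<delta> / 2) * (T n powr - H * u) = T n powr (- \<delta> / 2) * u"
      using T(2)[of n] by (simp add: powr_add[symmetric] mult.assoc[symmetric])
    then show ?thesis
      unfolding \<nu>_def E_def char_distr_scale[OF incr] distr_increment[OF ds stat a less_imp_le[OF T(2)]]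
        pT[OF T(2)] by (simp only:)
  qed
  have limit: "char_limit \<nu> (\<lambda>u. exp (L u))" if "\<And>u. (\<lambda>n. E n u) \<longlonglongrightarrow> L u" for L
    using that by (intro char_limit.intro real_distr) (simp only: char_\<nu> tendsto_exp)
  \<comment> \<open>This serves both nonzero signs of \<delta>: \<open>v\<close> will be the
    variance of \<open>X 1\<close> when \<delta> < 0 and its Gaussian variance when \<delta> >
    0.\<close>
  have gaussian_case: thesis if v: "0 < v" and lim: "\<And>u. (\<lambda>n. E n u) \<longlonglongrightarrow> complex_of_real (- v * u\<^sup>2 / 2)" for v
  proof (rule witness)
    show "char_limit (\<lambda>n. distr M borel (\<lambda>\<omega>. T n powr - H * (X (a + T n) \<omega> - X a \<omega>)))
        (\<lambda>u. exp (complex_of_real (- v * u\<^sup>2 / 2)))"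
      using limit[OF lim] unfolding \<nu>_def .
    show "isCont (\<lambda>u. exp (complex_of_real (- v * u\<^sup>2 / 2))) 0"
      by (intro continuous_intros) auto
    have "((\<lambda>u. complex_of_real (exp (- v * u\<^sup>2 / 2))) \<longlongrightarrow> complex_of_real 0) at_infinity"
      by (intro tendsto_of_real gaussian_char_at_infinity v)
    then show "((\<lambda>u. exp (complex_of_real (- v * u\<^sup>2 / 2))) \<longlongrightarrow> 0) at_infinity"
      by (simp only: exp_of_real of_real_0)
  qed simp
  show thesis
  proof (cases "\<delta> < 0")
    case True
    define V where "V = expectation (\<lambda>\<omega>. (X 1 \<omega>)\<^sup>2)"
    have moments: "integrable M (\<lambda>\<omega>. \<bar>X 1 \<omega>\<bar> ^ k)" for k
      using ds by (simp add: dilatively_stable_def)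
    have "integrable M (\<lambda>\<omega>. (X 1 \<omega>)\<^sup>2)"
      using moments[of 2] by simp
    moreover have "\<not> gaussian (distr M borel (X 1))"
      using ds by (simp add: dilatively_stable_def)
    ultimately have "0 < V"
      unfolding V_def using X[of 1] by (intro second_moment_pos) auto
    moreover have "(\<lambda>n. E n u) \<longlonglongrightarrow> complex_of_real (- V * u\<^sup>2 / 2)" for u
    \<comment> \<open>The quadratic limit of \<open>p\<close> is taken over punctured neighbourhoods
      of 0, so the arguments \<open>w n\<close> below must be nonzero.\<close>
    proof (cases "u = 0")
      case True
      then show ?thesis
        using p(2) by (simp add: E_def)
    next
      case False
      have "expectation (X 1) = 0"
        using zm by (simp add: zero_mean_def)
      then have "((\<lambda>u. (char (distr M borel (X 1)) u - 1) / of_real (u\<^sup>2)) \<longlongrightarrow> - complex_of_real (V / 2)) (at 0)"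
        unfolding V_def using X[of 1] moments by (intro char_distr_quadratic_limit) auto
      then have quad: "((\<lambda>u. p u / of_real (u\<^sup>2)) \<longlongrightarrow> - complex_of_real (V / 2)) (at 0)"
        by (rule exp_logarithm_quadratic_limit[OF cont_p p(2,3)])
      define w where "w n = T n powr (- \<delta> / 2) * u" for n
      have "(\<lambda>n. T n powr (- \<delta> / 2) * u) \<longlonglongrightarrow> 0 * u"
        using T \<open>\<delta> < 0\<close> by (intro tendsto_intros powr_tendsto_0) auto
      then have "filterlim w (at 0) sequentially"
        using False less_imp_neq[OF T(2)] unfolding filterlim_at w_def by (auto simp: powr_eq_0_iff)
      then have "(\<lambda>n. p (w n) / of_real ((w n)\<^sup>2)) \<longlonglongrightarrow> - complex_of_real (V / 2)"
        by (rule filterlim_compose[OF quad])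
      then have "(\<lambda>n. p (w n) / of_real ((w n)\<^sup>2) * of_real (u\<^sup>2)) \<longlonglongrightarrow> - complex_of_real (V / 2) * of_real (u\<^sup>2)"
        by (intro tendsto_intros)
      \<comment> \<open>The factor \<open>T n powr \<delta>\<close> in \<open>E n u\<close> equals
        \<open>u\<^sup>2 / (w n)\<^sup>2\<close>, so \<open>E n u\<close> is a multiple of the
        quotient controlled by \<open>quad\<close>.\<close>
      moreover have "p (w n) / of_real ((w n)\<^sup>2) * of_real (u\<^sup>2) = E n u" for n
      proof -
        have w2: "(w n)\<^sup>2 = T n powr - \<delta> * u\<^sup>2"
          using T(2)[of n] by (simp add: w_def power_mult_distrib powr_power)
        have "u\<^sup>2 / (w n)\<^sup>2 = T n powr \<delta>"
          unfolding w2 using T(2)[of n] False by (simp add: powr_minus_divide)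
        then have ratio: "complex_of_real (u\<^sup>2) / complex_of_real ((w n)\<^sup>2) = complex_of_real (T n powr \<delta>)"
          by (metis of_real_divide)
        have "p (w n) / complex_of_real ((w n)\<^sup>2) * complex_of_real (u\<^sup>2) =
            complex_of_real (u\<^sup>2) / complex_of_real ((w n)\<^sup>2) * p (w n)"
          unfolding times_divide_eq_left by (simp only: mult.commute)
        also have "\<dots> = E n u"
          unfolding ratio by (simp only: E_def w_def)
        finally show ?thesis .
      qed
      ultimately show ?thesis
        by simp
    qed
    ultimately show ?thesis
      by (rule gaussian_case)
  next
    case False
    then obtain b v \<Lambda> where lk: "levy_khintchine (distr M borel (X 1)) b v \<Lambda>" and v: "0 < v"
      using gauss by (auto simp: has_gaussian_component_def)
    then have levy: "levy_measure \<Lambda>"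
      by (simp add: levy_khintchine_def)
    \<comment> \<open>Both sides are continuous logarithms of the characteristic function of
      \<open>X 1\<close> that vanish at 0, so the exponent is available far from 0, where moments
      give no information.\<close>
    have p_eq: "p = lk_exponent b v \<Lambda>"
    proof (rule continuous_logarithm_unique)
      show "exp (p u) = exp (lk_exponent b v \<Lambda> u)" for u
        using lk p(3)[of u] by (simp add: levy_khintchine_def lk_exponent_def lk_kernel_def)
    qed (use p levy in \<open>auto simp: lk_exponent_0 intro: continuous_lk_exponent\<close>)
    show ?thesis
    proof (cases "\<delta> = 0")
      case True
      show ?thesis
      proof (rule witness)
        have "E n u = p u" for n u
          using T(2)[of n] True by (simp add: E_def)
        then show "char_limit (\<lambda>n. distr M borel (\<lambda>\<omega>. T n powr - H * (X (a + T n) \<omega> - X a \<omega>)))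
            (\<lambda>u. exp (p u))"
          using limit[of p] unfolding \<nu>_def by simp
        show "isCont (\<lambda>u. exp (p u)) 0"
          by (intro isCont_exp' cont_p)
        show "((\<lambda>u. exp (p u)) \<longlongrightarrow> 0) at_infinity"
        proof (rule Lim_null_comparison[OF _ gaussian_char_at_infinity[OF v]])
          show "\<forall>\<^sub>F u in at_infinity. norm (exp (p u)) \<le> exp (- v * u\<^sup>2 / 2)"
            unfolding p_eq norm_exp_eq_Re using Re_lk_exponent_le[OF levy]
            by (intro always_eventually) simp
        qed
      qed (simp add: p(2))
    next
      case nz: False
      have "(\<lambda>n. E n u) \<longlonglongrightarrow> complex_of_real (- v * u\<^sup>2 / 2)" for u
      proof -
        \<comment> \<open>With this choice \<open>(s n)\<^sup>2\<close> is the convolution exponent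
          and \<open>u / s n\<close> the argument of \<open>p\<close>, as in
          \<open>lk_exponent_scaled_limit\<close>.\<close>
        define s where "s n = T n powr (\<delta> / 2)" for n
        have "s \<longlonglongrightarrow> 0"
          unfolding s_def using T False nz by (intro powr_tendsto_0) auto
        moreover have "0 < s n" "s n \<le> 1" for n
          using T(2,3)[of n] False by (auto simp: s_def intro!: powr_le1)
        ultimately have "(\<lambda>n. complex_of_real ((s n)\<^sup>2) * lk_exponent b v \<Lambda> (u / s n)) \<longlonglongrightarrow>
            complex_of_real (- v * u\<^sup>2 / 2)"
          by (intro lk_exponent_scaled_limit levy)
        moreover have "complex_of_real ((s n)\<^sup>2) * lk_exponent b v \<Lambda> (u / s n) = E n u" for n
        proof -
          have "(s n)\<^sup>2 = T n powr \<delta>"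
            using T(2)[of n] by (simp add: s_def powr_power)
          moreover have "u / s n = T n powr (- \<delta> / 2) * u"
            by (simp add: s_def powr_minus_divide)
          ultimately show ?thesis
            by (simp add: E_def p_eq)
        qed
        ultimately show ?thesis
          by simp
      qed
      with v show ?thesis
        by (rule gaussian_case)
    qed
  qed
qed

text \<open>The threshold \<open>T powr h\<close> for an increment becomes
  \<open>T powr (h - H)\<close> after normalisation. As \<open>T\<close> decreases to 0 this tends
  to 0 if \<open>H < h\<close> and to infinity if \<open>h < H\<close>, matching the two
  concentration lemmas.\<close>

lemma measure_scaled_increment:
  fixes D :: "'a \<Rightarrow> real" and T H h :: real
  assumes "D \<in> borel_measurable M" "0 < T"
  shows "measure (distr M borel (\<lambda>\<omega>. T powr - H * D \<omega>)) {y. \<bar>y\<bar> \<le> T powr (h - H)} =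
           measure M {\<omega> \<in> space M. \<bar>D \<omega>\<bar> \<le> T powr h}" (is ?le)
    and "measure (distr M borel (\<lambda>\<omega>. T powr - H * D \<omega>)) {y. T powr (h - H) < \<bar>y\<bar>} =
           measure M {\<omega> \<in> space M. T powr h < \<bar>D \<omega>\<bar>}" (is ?gt)
proof -
  have "\<bar>T powr - H * d\<bar> \<le> T powr (h - H) \<longleftrightarrow> \<bar>d\<bar> \<le> T powr h" for d
  proof -
    have "T powr (h - H) = T powr - H * T powr h"
      using powr_add[of T "- H" h] by simp
    then show ?thesis
      using assms(2) by (simp add: abs_mult)
  qed
  then show ?le ?gt
    using assms(1) by (subst measure_distr; auto intro!: arg_cong[where f = "measure M"] simp: not_le[symmetric])+
qed

context
  fixes H \<delta> a :: real and M :: "'a measure" and X :: "real \<Rightarrow> 'a \<Rightarrow> real" and T :: "nat \<Rightarrow> real"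
  assumes ds: "dilatively_stable H \<delta> M X" and stat: "stationary_increments M X"
    and zm: "zero_mean M X"
    and gauss: "\<delta> \<ge> 0 \<longrightarrow> has_gaussian_component (distr M borel (X 1))"
    and a: "0 \<le> a" and T: "T \<longlonglongrightarrow> 0" "\<And>n. 0 < T n" "\<And>n. T n \<le> 1"
begin

lemma increment_measurable: "(\<lambda>\<omega>. X (a + T n) \<omega> - X a \<omega>) \<in> borel_measurable M"
  using ds a less_imp_le[OF T(2)[of n]]
  by (intro borel_measurable_diff) (auto simp: dilatively_stable_def real_process_def)

lemma increments_rarely_small:
  assumes "H < h"
  shows "(\<lambda>n. measure M {\<omega> \<in> space M. \<bar>X (a + T n) \<omega> - X a \<omega>\<bar> \<le> T n powr h}) \<longlonglongrightarrow> 0"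
proof -
  obtain g where g: "char_limit (\<lambda>n. distr M borel (\<lambda>\<omega>. T n powr - H * (X (a + T n) \<omega> - X a \<omega>))) g"
      "(g \<longlongrightarrow> 0) at_infinity"
    using rescaled_increments_char_limit[OF ds stat zm gauss a T] by blast
  have "(\<lambda>n. T n powr (h - H)) \<longlonglongrightarrow> 0"
    using T assms by (intro powr_tendsto_0) auto
  from char_limit.no_mass_near_0[OF g this] show ?thesis
    unfolding measure_scaled_increment(1)[OF increment_measurable T(2)] .
qed

lemma increments_rarely_large:
  assumes "h < H"
  shows "(\<lambda>n. measure M {\<omega> \<in> space M. T n powr h < \<bar>X (a + T n) \<omega> - X a \<omega>\<bar>}) \<longlonglongrightarrow> 0"
proof -
  obtain g where g: "char_limit (\<lambda>n. distr M borel (\<lambda>\<omega>. T n powr - H * (X (a + T n) \<omega> - X a \<omega>))) g"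
      "isCont g 0" "g 0 = 1"
    using rescaled_increments_char_limit[OF ds stat zm gauss a T] by blast
  have "filterlim (\<lambda>n. inverse (T n powr (H - h))) at_top sequentially"
    using T assms
    by (intro filterlim_inverse_at_top powr_tendsto_0) (auto intro!: always_eventually simp: less_imp_neq[symmetric])
  then have "filterlim (\<lambda>n. T n powr (h - H)) at_top sequentially"
    by (simp flip: powr_minus)
  from char_limit.no_mass_at_infinity[OF g this] show ?thesis
    unfolding measure_scaled_increment(2)[OF increment_measurable T(2)] .
qed

end

section \<open>The path space\<close>

text \<open>Choose indices \<open>r k\<close> whose two error probabilities are below
  \<open>(1 / 2) ^ k\<close>. By Borel--Cantelli, almost every point under \<open>M\<close> lies in
  all but finitely many \<open>A (r k)\<close>, and almost every point under \<open>Q\<close> in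
  only finitely many. The lower limit of these events separates the laws.\<close>

lemma (in prob_space) singular_events:
  assumes Q: "prob_space Q" and sets: "sets M = sets Q"
    and A: "\<And>n. A n \<in> sets M"
    and M: "(\<lambda>n. prob (space M - A n)) \<longlonglongrightarrow> 0" and Q0: "(\<lambda>n. measure Q (A n)) \<longlonglongrightarrow> 0"
  obtains B where "B \<in> sets M" "emeasure M B = 1" "emeasure Q B = 0"
proof -
  interpret Q: prob_space Q by (rule Q)
  have "(\<lambda>n. prob (space M - A n) + measure Q (A n)) \<longlonglongrightarrow> 0 + 0"
    by (intro tendsto_add M Q0)
  then have "\<exists>n. prob (space M - A n) + measure Q (A n) < (1 / 2) ^ k" for k :: nat
    using order_tendstoD(2)[of _ "0 + 0" sequentially "(1 / 2 :: real) ^ k"]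
    by (auto simp: eventually_sequentially)
  then obtain r where r: "\<And>k. prob (space M - A (r k)) + measure Q (A (r k)) < (1 / 2) ^ k"
    by metis
  have r': "prob (space M - A (r k)) \<le> (1 / 2) ^ k" "measure Q (A (r k)) \<le> (1 / 2) ^ k" for k
    using r[of k] measure_nonneg[of M "space M - A (r k)"] measure_nonneg[of Q "A (r k)"] by linarith+
  note [measurable] = A
  have AQ [measurable]: "A n \<in> sets Q" for n
    using A sets by simp
  have summable: "summable (\<lambda>k. (1 / 2 :: real) ^ k)"
    by (simp add: summable_geometric)
  have "AE x in M. \<forall>\<^sub>F k in sequentially. x \<in> space M - (space M - A (r k))"
    using r' by (intro borel_cantelli_AE1 summable_comparison_test'[OF summable, of 0])
      (auto simp: less_top[symmetric])
  then have AE_M: "AE x in M. \<forall>\<^sub>F k in sequentially. x \<in> A (r k)"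
    by eventually_elim (auto elim: eventually_mono)
  have "AE x in Q. \<forall>\<^sub>F k in sequentially. x \<in> space Q - A (r k)"
    using r' by (intro borel_cantelli_AE1 summable_comparison_test'[OF summable, of 0])
      (auto simp: Q.emeasure_eq_measure)
  then have AE_Q: "AE x in Q. \<not> (\<forall>\<^sub>F k in sequentially. x \<in> A (r k))"
  proof eventually_elim
    case (elim x)
    show ?case
    proof
      assume "\<forall>\<^sub>F k in sequentially. x \<in> A (r k)"
      with elim have "\<forall>\<^sub>F k in sequentially. False"
        by eventually_elim auto
      then show False
        by simp
    qed
  qed
  define B where "B = {x \<in> space M. \<forall>\<^sub>F k in sequentially. x \<in> A (r k)}"
  have B: "B \<in> sets M"
    unfolding B_def eventually_sequentially by measurable
  show ?thesis
  proof
    have "AE x in M. x \<in> B"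
      using AE_M AE_space by eventually_elim (simp add: B_def)
    then show "emeasure M B = 1"
      using B by (simp add: emeasure_eq_1_AE)
    have "AE x in Q. x \<notin> B"
      using AE_Q by eventually_elim (simp add: B_def)
    then show "emeasure Q B = 0"
      using B sets by (subst (asm) AE_iff_measurable[OF _ refl]) (auto simp: B_def sets_eq_imp_space_eq[OF sets] Int_def)
  qed (rule B)
qed

section \<open>Evaluations and the Borel sets of the path space\<close>

text \<open>
  The tubes need not be open, but every open set is a union of finite intersections of tubes, and a
  tube only depends on the evaluations at countably many points. Hence \<open>borel_C I\<close> is generated by
  the evaluations.
\<close>

definition tube :: "real set \<Rightarrow> real set \<Rightarrow> real \<Rightarrow> real \<Rightarrow> (real \<Rightarrow> real) set" where
  "tube I V p q = {h \<in> C_space I. \<forall>x\<in>V \<inter> I. p \<le> h x \<and> h x \<le> q}"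

text \<open>Rational bounds keep the family countable for a countable \<V>. The factor
  \<open>C_space I\<close> gives the correct value for the empty family, whose intersection is
  \<open>UNIV\<close>.\<close>

definition tube_basis :: "real set \<Rightarrow> real set set \<Rightarrow> (real \<Rightarrow> real) set set" where
  "tube_basis I \<V> =
     (\<lambda>F. C_space I \<inter> \<Inter>F) ` {F. finite F \<and> F \<subseteq> (\<lambda>(V, p, q). tube I V p q) ` (\<V> \<times> \<rat> \<times> \<rat>)}"

lemma countable_tube_basis:
  assumes "countable \<V>"
  shows "countable (tube_basis I \<V>)"
  unfolding tube_basis_def
  by (intro countable_image countable_Collect_finite_subset countable_SIGMA assms countable_rat)

lemma tube_basis_Int:
  assumes "B \<in> tube_basis I \<V>" "B' \<in> tube_basis I \<V>"
  shows "B \<inter> B' \<in> tube_basis I \<V>"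
proof -
  obtain F F' where "finite F" "F \<subseteq> (\<lambda>(V, p, q). tube I V p q) ` (\<V> \<times> \<rat> \<times> \<rat>)" "B = C_space I \<inter> \<Inter>F"
      "finite F'" "F' \<subseteq> (\<lambda>(V, p, q). tube I V p q) ` (\<V> \<times> \<rat> \<times> \<rat>)" "B' = C_space I \<inter> \<Inter>F'"
    using assms by (auto simp: tube_basis_def)
  then show ?thesis
    unfolding tube_basis_def by (intro image_eqI[of _ _ "F \<union> F'"]) auto
qed

text \<open>Take \<open>p\<close> and \<open>q\<close> within \<eta> of \<open>g x\<close>, and
  \<open>V\<close> so small that \<open>g\<close> stays between them and \<open>f\<close> moves by
  less than \<eta>. A function in the tube then differs from \<open>f\<close> on \<open>V\<close>
  \<inter> \<open>I\<close> by less than \<open>\<bar>g x - f x\<bar> + 2 * \<eta>\<close>, which is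
  below \<epsilon>.\<close>

lemma tube_neighbourhood:
  assumes \<V>: "topological_basis \<V>" and g: "g \<in> C_space I" and f: "f \<in> C_space I"
    and x: "x \<in> I" and less: "\<bar>g x - f x\<bar> < \<epsilon>"
  obtains V p q where "V \<in> \<V>" "p \<in> \<rat>" "q \<in> \<rat>" "x \<in> V" "g \<in> tube I V p q"
    "\<And>h y. h \<in> tube I V p q \<Longrightarrow> y \<in> V \<inter> I \<Longrightarrow> \<bar>h y - f y\<bar> < \<epsilon>"
proof -
  define \<eta> where "\<eta> = (\<epsilon> - \<bar>g x - f x\<bar>) / 4"
  have \<eta>: "0 < \<eta>" "\<epsilon> = \<bar>g x - f x\<bar> + 4 * \<eta>"
    using less by (simp_all add: \<eta>_def add_divide_distrib diff_divide_distrib)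
  obtain p where p: "p \<in> \<rat>" "g x - \<eta> < p" "p < g x"
    using Rats_dense_in_real[of "g x - \<eta>" "g x"] \<eta> by auto
  obtain q where q: "q \<in> \<rat>" "g x < q" "q < g x + \<eta>"
    using Rats_dense_in_real[of "g x" "g x + \<eta>"] \<eta> by auto
  have "(g \<longlongrightarrow> g x) (at x within I)" "(f \<longlongrightarrow> f x) (at x within I)"
    using f g x by (auto simp: C_space_def continuous_on_def)
  then have "\<forall>\<^sub>F y in at x within I. p < g y \<and> g y < q \<and> dist (f y) (f x) < \<eta>"
    using p q \<eta>(1) by (intro eventually_conj order_tendstoD tendstoD)
  then obtain d where d: "0 < d"
      "\<And>y. y \<in> I \<Longrightarrow> y \<noteq> x \<Longrightarrow> dist y x < d \<Longrightarrow> p < g y \<and> g y < q \<and> dist (f y) (f x) < \<eta>"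
    by (auto simp: eventually_at)
  then have d': "p < g y \<and> g y < q \<and> dist (f y) (f x) < \<eta>" if "y \<in> I" "dist y x < d" for y
    using that p q \<eta>(1) by (cases "y = x") auto
  obtain V where V: "V \<in> \<V>" "x \<in> V" "V \<subseteq> ball x d"
    using topological_basisE[OF \<V>, of "ball x d" x] d(1) by auto
  then have Vd: "dist y x < d" if "y \<in> V" for y
    using that by (auto simp: dist_commute)
  show ?thesis
  proof
    show "g \<in> tube I V p q"
      using g d' Vd by (auto simp: tube_def less_imp_le)
    show "\<bar>h y - f y\<bar> < \<epsilon>" if h: "h \<in> tube I V p q" and y: "y \<in> V \<inter> I" for h y
    proof -
      have "p \<le> h y" "h y \<le> q"
        using h y by (auto simp: tube_def)
      moreover have "\<bar>f y - f x\<bar> < \<eta>"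
        using d' Vd y by (auto simp: dist_real_def)
      ultimately show ?thesis
        using p q \<eta> by linarith
    qed
  qed (use p q V in auto)
qed

text \<open>Induction over the generation of the topology. For a generator,
  \<open>tube_neighbourhood\<close> gives a tube around each point of \<open>K\<close>, and
  compactness leaves finitely many of them, whose intersection belongs to the basis.\<close>

lemma tube_basis_open:
  assumes \<V>: "topological_basis \<V>" and U: "openin (local_uniform_topology I) U" and g: "g \<in> U"
  obtains B where "B \<in> tube_basis I \<V>" "g \<in> B" "B \<subseteq> U"
proof -
  have "generate_topology_on {{g \<in> C_space I. \<forall>x\<in>K. \<bar>g x - f x\<bar> < \<epsilon>} | f K \<epsilon>.
        f \<in> C_space I \<and> compact K \<and> K \<subseteq> I \<and> \<epsilon> > 0} U"
    using U unfolding local_uniform_topology_def by (rule openin_topology_generated_by)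
  then have "\<forall>g\<in>U. \<exists>B\<in>tube_basis I \<V>. g \<in> B \<and> B \<subseteq> U"
  proof induction
    case (Int U U')
    show ?case
    proof
      fix g assume "g \<in> U \<inter> U'"
      then obtain B B' where "B \<in> tube_basis I \<V>" "g \<in> B" "B \<subseteq> U"
          "B' \<in> tube_basis I \<V>" "g \<in> B'" "B' \<subseteq> U'"
        using Int.IH by blast
      then show "\<exists>B\<in>tube_basis I \<V>. g \<in> B \<and> B \<subseteq> U \<inter> U'"
        by (intro bexI[of _ "B \<inter> B'"] tube_basis_Int) auto
    qed
  next
    case (UN \<U>)
    then show ?case
      by (meson UnionE Union_upper subset_trans)
  next
    case (Basis s)
    then obtain f K \<epsilon> where s: "s = {g \<in> C_space I. \<forall>x\<in>K. \<bar>g x - f x\<bar> < \<epsilon>}"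
        and f: "f \<in> C_space I" and K: "compact K" "K \<subseteq> I"
      by blast
    show ?case
    proof
      fix g assume "g \<in> s"
      then have g: "g \<in> C_space I" and gf: "\<And>x. x \<in> K \<Longrightarrow> \<bar>g x - f x\<bar> < \<epsilon>"
        by (auto simp: s)
      have "\<exists>V p q. V \<in> \<V> \<and> p \<in> \<rat> \<and> q \<in> \<rat> \<and> x \<in> V \<and> g \<in> tube I V p q \<and>
          (\<forall>h\<in>tube I V p q. \<forall>y\<in>V \<inter> I. \<bar>h y - f y\<bar> < \<epsilon>)" if "x \<in> K" for x
        using tube_neighbourhood[OF \<V> g f _ gf[OF that]] K(2) that by (metis subsetD)
      then obtain V p q where Vpq: "\<And>x. x \<in> K \<Longrightarrow> V x \<in> \<V> \<and> p x \<in> \<rat> \<and> q x \<in> \<rat> \<and> x \<in> V x \<and>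
          g \<in> tube I (V x) (p x) (q x) \<and> (\<forall>h\<in>tube I (V x) (p x) (q x). \<forall>y\<in>V x \<inter> I. \<bar>h y - f y\<bar> < \<epsilon>)"
        by metis
      have "open (V x)" if "x \<in> K" for x
        using topological_basis_open[OF \<V>] Vpq[OF that] by blast
      moreover have "K \<subseteq> (\<Union>x\<in>K. V x)"
        using Vpq by blast
      ultimately obtain K' where K': "K' \<subseteq> K" "finite K'" "K \<subseteq> (\<Union>x\<in>K'. V x)"
        using compactE_image[OF K(1)] by metis
      define B where "B = C_space I \<inter> (\<Inter>x\<in>K'. tube I (V x) (p x) (q x))"
      have "B \<in> tube_basis I \<V>"
        unfolding B_def tube_basis_def
      proof (intro imageI CollectI conjI)
        show "(\<lambda>x. tube I (V x) (p x) (q x)) ` K' \<subseteq> (\<lambda>(V, p, q). tube I V p q) ` (\<V> \<times> \<rat> \<times> \<rat>)"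
          using K'(1) Vpq by (force simp: image_subset_iff)
      qed (use K' in auto)
      moreover have "g \<in> B"
        using g K'(1) Vpq by (auto simp: B_def)
      moreover have "B \<subseteq> s"
        unfolding B_def s using K' K(2) Vpq by blast
      ultimately show "\<exists>B\<in>tube_basis I \<V>. g \<in> B \<and> B \<subseteq> s"
        by blast
    qed
  qed simp
  then show ?thesis
    using g that by blast
qed

text \<open>\<open>D\<close> is a countable dense subset of \<open>V\<close> \<inter>
  \<open>I\<close>. The preimage of a closed interval under a continuous function is closed in
  \<open>I\<close>, so the non-strict bounds extend from \<open>D\<close> to its closure. One
  \<open>D\<close> works for all \<open>p\<close> and \<open>q\<close>.\<close>

lemma tube_countable:
  fixes I V :: "real set"
  obtains D where "countable D" "D \<subseteq> I"
    "\<And>p q. tube I V p q = {h \<in> C_space I. \<forall>x\<in>D. p \<le> h x \<and> h x \<le> q}"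
proof -
  obtain D where D: "countable D" "D \<subseteq> V \<inter> I" "V \<inter> I \<subseteq> closure D"
    using separable[of "V \<inter> I"] by blast
  have "p \<le> h x \<and> h x \<le> q"
    if h: "h \<in> C_space I" "\<forall>x\<in>D. p \<le> h x \<and> h x \<le> q" and x: "x \<in> V \<inter> I" for h p q x
  proof -
    have "closedin (top_of_set I) (I \<inter> h -` {p..q})"
      using h by (intro continuous_closedin_preimage) (auto simp: C_space_def)
    then obtain S where S: "closed S" "I \<inter> h -` {p..q} = I \<inter> S"
      by (auto simp: closedin_closed)
    have "D \<subseteq> S"
      using S(2) h(2) D(2) by fastforce
    then have "closure D \<subseteq> S"
      by (rule closure_minimal) (rule S)
    then have "x \<in> I \<inter> S"
      using x D(3) by auto
    then show ?thesis
      unfolding S(2)[symmetric] by simp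
  qed
  then have "tube I V p q = {h \<in> C_space I. \<forall>x\<in>D. p \<le> h x \<and> h x \<le> q}" for p q
    unfolding tube_def using D(2) by blast
  with D show ?thesis
    by (intro that[of D]) auto
qed

text \<open>The preimage of a tube is a countable intersection of evaluation events, and an open set
  is a union of elements of a countable basis made of tubes. So measurability of every evaluation
  suffices.\<close>

lemma measurable_borel_C:
  assumes \<Phi>: "\<Phi> \<in> space N \<rightarrow> C_space I"
    and ev: "\<And>x. x \<in> I \<Longrightarrow> (\<lambda>\<omega>. \<Phi> \<omega> x) \<in> borel_measurable N"
  shows "\<Phi> \<in> measurable N (borel_C I)"
  unfolding borel_C_def
proof (rule measurable_measure_of)
  show "{U. openin (local_uniform_topology I) U} \<subseteq> Pow (C_space I)"
    using openin_subset topspace_local_uniform_topology by fastforce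
  obtain \<V> :: "real set set" where \<V>: "countable \<V>" "topological_basis \<V>"
    using ex_countable_basis by blast
  have tube: "\<Phi> -` tube I V p q \<inter> space N \<in> sets N" for V p q
  proof -
    obtain D where D: "countable D" "D \<subseteq> I"
        "\<And>p q. tube I V p q = {h \<in> C_space I. \<forall>x\<in>D. p \<le> h x \<and> h x \<le> q}"
      using tube_countable[where I = I and V = V] by blast
    have "{\<omega> \<in> space N. \<forall>x\<in>D. p \<le> \<Phi> \<omega> x \<and> \<Phi> \<omega> x \<le> q} \<in> sets N"
    proof (rule sets.sets_Collect_countable_All'[OF _ D(1)])
      fix x assume "x \<in> D"
      then have [measurable]: "(\<lambda>\<omega>. \<Phi> \<omega> x) \<in> borel_measurable N"
        using ev D(2) by blast
      show "{\<omega> \<in> space N. p \<le> \<Phi> \<omega> x \<and> \<Phi> \<omega> x \<le> q} \<in> sets N"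
        by measurable
    qed
    moreover have "\<Phi> -` tube I V p q \<inter> space N = {\<omega> \<in> space N. \<forall>x\<in>D. p \<le> \<Phi> \<omega> x \<and> \<Phi> \<omega> x \<le> q}"
      using \<Phi> unfolding D(3) by auto
    ultimately show ?thesis
      by simp
  qed
  have basis: "\<Phi> -` B \<inter> space N \<in> sets N" if B: "B \<in> tube_basis I \<V>" for B
  proof -
    obtain F where F: "finite F" "F \<subseteq> (\<lambda>(V, p, q). tube I V p q) ` (\<V> \<times> \<rat> \<times> \<rat>)" "B = C_space I \<inter> \<Inter>F"
      using B by (auto simp: tube_basis_def)
    have "{\<omega> \<in> space N. \<forall>S\<in>F. \<Phi> \<omega> \<in> S} \<in> sets N"
    proof (rule sets.sets_Collect_countable_All'[OF _ countable_finite[OF F(1)]])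
      fix S assume "S \<in> F"
      then obtain V p q where "S = tube I V p q"
        using F(2) by auto
      then show "{\<omega> \<in> space N. \<Phi> \<omega> \<in> S} \<in> sets N"
        using tube[of V p q] by (simp add: vimage_def Int_def conj_commute)
    qed
    moreover have "\<Phi> -` B \<inter> space N = {\<omega> \<in> space N. \<forall>S\<in>F. \<Phi> \<omega> \<in> S}"
      using \<Phi> unfolding F(3) by auto
    ultimately show ?thesis
      by simp
  qed
  show "\<Phi> -` U \<inter> space N \<in> sets N" if "U \<in> {U. openin (local_uniform_topology I) U}" for U
  proof -
    define \<C> where "\<C> = {B \<in> tube_basis I \<V>. B \<subseteq> U}"
    have "U = \<Union>\<C>"
      using tube_basis_open[OF \<V>(2)] that unfolding \<C>_def by blast
    then have "\<Phi> -` U \<inter> space N = (\<Union>B\<in>\<C>. \<Phi> -` B \<inter> space N)"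
      by auto
    also have "\<dots> \<in> sets N"
      using countable_tube_basis[OF \<V>(1), of I] basis
      by (intro sets.countable_UN') (auto simp: \<C>_def intro: countable_subset)
    finally show ?thesis .
  qed
qed (rule \<Phi>)

lemma space_borel_C: "space (borel_C I) = C_space I"
  unfolding borel_C_def using openin_subset topspace_local_uniform_topology
  by (subst space_measure_of) fastforce+

text \<open>The set \<open>{t}\<close> is compact, so closeness at \<open>t\<close> alone already
  defines a generator of the topology, and evaluation at \<open>t\<close> is continuous.\<close>

lemma evaluation_measurable:
  assumes t: "t \<in> I"
  shows "(\<lambda>f. f t) \<in> borel_measurable (borel_C I)"
proof (rule borel_measurableI)
  fix S :: "real set" assume "open S"
  have "openin (local_uniform_topology I) {f \<in> C_space I. f t \<in> S}"
  proof (subst openin_subopen, intro ballI)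
    fix f assume "f \<in> {f \<in> C_space I. f t \<in> S}"
    then have f: "f \<in> C_space I" "f t \<in> S"
      by auto
    then obtain e where e: "0 < e" "ball (f t) e \<subseteq> S"
      using \<open>open S\<close> openE by blast
    define U where "U = {g \<in> C_space I. \<forall>x\<in>{t}. \<bar>g x - f x\<bar> < e}"
    have "openin (local_uniform_topology I) U"
      unfolding local_uniform_topology_def
    proof (rule topology_generated_by_Basis, intro CollectI exI conjI)
      show "U = {g \<in> C_space I. \<forall>x\<in>{t}. \<bar>g x - f x\<bar> < e}"
        by (rule U_def)
    qed (use f e t in auto)
    moreover have "f \<in> U"
      using f e by (simp add: U_def)
    moreover have "U \<subseteq> {f \<in> C_space I. f t \<in> S}"
      using e(2) by (auto simp: U_def dist_real_def subset_iff abs_minus_commute)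
    ultimately show "\<exists>U. openin (local_uniform_topology I) U \<and> f \<in> U \<and> U \<subseteq> {f \<in> C_space I. f t \<in> S}"
      by blast
  qed
  moreover have "(\<lambda>f. f t) -` S \<inter> space (borel_C I) = {f \<in> C_space I. f t \<in> S}"
    by (auto simp: space_borel_C)
  moreover have "{U. openin (local_uniform_topology I) U} \<subseteq> Pow (C_space I)"
    using openin_subset topspace_local_uniform_topology by fastforce
  ultimately show "(\<lambda>f. f t) -` S \<inter> space (borel_C I) \<in> sets (borel_C I)"
    by (simp add: borel_C_def)
qed

section \<open>The law of the sample paths\<close>

context
  fixes M :: "'a measure" and X :: "real \<Rightarrow> 'a \<Rightarrow> real" and I :: "real set"
  assumes proc: "real_process M X" and cont: "ae_continuous_paths M X I" and I: "I \<subseteq> {0..}"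
begin

definition sample_path :: "'a \<Rightarrow> real \<Rightarrow> real" where
  "sample_path \<omega> = (if continuous_on I (\<lambda>t. X t \<omega>) then (\<lambda>t\<in>I. X t \<omega>) else (\<lambda>t\<in>I. 0))"

lemma AE_sample_path: "AE \<omega> in completion M. \<forall>t\<in>I. sample_path \<omega> t = X t \<omega>"
  using cont unfolding ae_continuous_paths_def
  by (intro AE_completion) (auto simp: sample_path_def elim: eventually_mono)

text \<open>Each evaluation agrees almost everywhere with the measurable \<open>X t\<close>, and in
  a completion a set almost everywhere equal to a measurable set is measurable. This avoids asking
  whether the event of continuity lies in \<open>sets M\<close>.\<close>

lemma measurable_sample_path: "sample_path \<in> measurable (completion M) (borel_C I)"
proof (rule measurable_borel_C)
  show "sample_path \<in> space (completion M) \<rightarrow> C_space I"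
    by (auto simp: sample_path_def C_space_def)
  fix t assume t: "t \<in> I"
  then have Xt: "X t \<in> borel_measurable (completion M)"
    using proc I by (intro measurable_completion) (auto simp: real_process_def)
  show "(\<lambda>\<omega>. sample_path \<omega> t) \<in> borel_measurable (completion M)"
  proof (rule measurableI)
    fix S :: "real set" assume "S \<in> sets borel"
    then have preimage: "X t -` S \<inter> space (completion M) \<in> sets (completion M)"
      using Xt by (rule measurable_sets[rotated])
    have "AE \<omega> in completion M. \<omega> \<in> X t -` S \<inter> space (completion M) \<longleftrightarrow>
        \<omega> \<in> (\<lambda>\<omega>. sample_path \<omega> t) -` S \<inter> space (completion M)"
      using AE_sample_path by eventually_elim (use t in auto)
    then show "(\<lambda>\<omega>. sample_path \<omega> t) -` S \<inter> space (completion M) \<in> sets (completion M)"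
      by (rule completion.in_sets_AE[OF _ preimage]) auto
  qed simp
qed

lemma path_law_eq: "path_law M X I = distr (completion M) (borel_C I) sample_path"
  by (simp add: path_law_def sample_path_def [abs_def])

lemma prob_space_path_law: "prob_space (path_law M X I)"
  unfolding path_law_eq
proof (rule prob_space.prob_space_distr[OF _ measurable_sample_path])
  show "prob_space (completion M)"
    using proc by (simp add: real_process_def prob_space.prob_space_completion)
qed

text \<open>Carries the estimates for increments of the process over to the path space: sample path
  and process agree almost surely on \<open>I\<close>, and completion preserves the measure of sets
  in \<open>M\<close>.\<close>

lemma measure_path_law_increment:
  assumes "s \<in> I" "t \<in> I" and S: "S \<in> sets borel"
  shows "measure (path_law M X I) {f \<in> C_space I. f t - f s \<in> S} =
           measure M {\<omega> \<in> space M. X t \<omega> - X s \<omega> \<in> S}"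
proof -
  note [measurable] = evaluation_measurable[OF \<open>s \<in> I\<close>] evaluation_measurable[OF \<open>t \<in> I\<close>] S
  have [measurable]: "X s \<in> borel_measurable M" "X t \<in> borel_measurable M"
    using proc I assms by (auto simp: real_process_def)
  have A: "{f \<in> C_space I. f t - f s \<in> S} \<in> sets (borel_C I)"
    unfolding space_borel_C[symmetric] by measurable
  have B: "{\<omega> \<in> space M. X t \<omega> - X s \<omega> \<in> S} \<in> sets M"
    by measurable
  have "measure (path_law M X I) {f \<in> C_space I. f t - f s \<in> S} =
      measure (completion M) (sample_path -` {f \<in> C_space I. f t - f s \<in> S} \<inter> space (completion M))"
    unfolding path_law_eq by (rule measure_distr[OF measurable_sample_path A])
  also have "\<dots> = measure (completion M) {\<omega> \<in> space M. X t \<omega> - X s \<omega> \<in> S}"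
  proof (rule measure_eq_AE)
    show "AE \<omega> in completion M. \<omega> \<in> sample_path -` {f \<in> C_space I. f t - f s \<in> S} \<inter> space (completion M) \<longleftrightarrow>
        \<omega> \<in> {\<omega> \<in> space M. X t \<omega> - X s \<omega> \<in> S}"
      using AE_sample_path AE_space
    proof eventually_elim
      case (elim \<omega>)
      have "sample_path \<omega> \<in> C_space I"
        by (auto simp: sample_path_def C_space_def)
      then show ?case
        using elim assms by simp
    qed
  qed (use measurable_sets[OF measurable_sample_path A] B in auto)
  also have "\<dots> = measure M {\<omega> \<in> space M. X t \<omega> - X s \<omega> \<in> S}"
    using B by (simp add: measure_def)
  finally show ?thesis .
qed

end

section \<open>Singularity\<close>

text \<open>The complement of a separating set separates in the other direction, which allows the
  exponents to be ordered.\<close>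

lemma singular_on_commute:
  assumes "prob_space (path_law M X I)" "prob_space (path_law N Y I)" "singular_on I M X N Y"
  shows "singular_on I N Y M X"
proof -
  interpret P: prob_space "path_law M X I" by (rule assms(1))
  interpret Q: prob_space "path_law N Y I" by (rule assms(2))
  obtain A where A: "A \<in> sets (borel_C I)" "emeasure (path_law M X I) A = 1" "emeasure (path_law N Y I) A = 0"
    using assms(3) by (auto simp: singular_on_def)
  have sets: "sets (path_law M X I) = sets (borel_C I)" "sets (path_law N Y I) = sets (borel_C I)"
    by (simp_all add: path_law_def)
  note space = sets[THEN sets_eq_imp_space_eq]
  have "emeasure (path_law M X I) (space (borel_C I) - A) = 0"
    using A emeasure_compl[of A "path_law M X I"] P.emeasure_space_1 by (simp add: sets space)
  moreover have "emeasure (path_law N Y I) (space (borel_C I) - A) = 1"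
    using A emeasure_compl[of A "path_law N Y I"] Q.emeasure_space_1 by (simp add: sets space)
  ultimately show ?thesis
    unfolding singular_on_def using A(1) by blast
qed

lemma singular_on_less:
  fixes I :: "real set"
    and M1 :: "'a measure" and X1 :: "real \<Rightarrow> 'a \<Rightarrow> real"
    and M2 :: "'b measure" and X2 :: "real \<Rightarrow> 'b \<Rightarrow> real"
  assumes I: "is_interval I" "I \<subseteq> {0..}" "\<exists>a\<in>I. \<exists>b\<in>I. a < b"
    and ds: "dilatively_stable H1 \<delta>1 M1 X1" "dilatively_stable H2 \<delta>2 M2 X2"
    and stat: "stationary_increments M1 X1" "stationary_increments M2 X2"
    and zm: "zero_mean M1 X1" "zero_mean M2 X2"
    and cont: "ae_continuous_paths M1 X1 I" "ae_continuous_paths M2 X2 I"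
    and gauss: "\<delta>1 \<ge> 0 \<longrightarrow> has_gaussian_component (distr M1 borel (X1 1))"
      "\<delta>2 \<ge> 0 \<longrightarrow> has_gaussian_component (distr M2 borel (X2 1))"
    and "H1 < H2"
  shows "singular_on I M1 X1 M2 X2"
proof -
  obtain a b where ab: "a \<in> I" "b \<in> I" "a < b"
    using I(3) by blast
  have a: "0 \<le> a"
    using ab(1) I(2) by auto
  \<comment> \<open>The bound \<open>b - a\<close> keeps \<open>a + T n\<close> inside the interval,
    and the bound 1 ensures \<open>T n\<close> \<le> 1, as the limit lemmas demand.\<close>
  define d where "d = min 1 (b - a)"
  have d: "0 < d" "d \<le> 1" "d \<le> b - a"
    using ab(3) by (auto simp: d_def)
  define T where "T n = d * (1 / real (Suc n))" for n
  have T_le: "T n \<le> d" for n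
    using d(1) mult_left_mono[of "1 / real (Suc n)" 1 d] by (simp add: T_def)
  have "T \<longlonglongrightarrow> d * 0"
    unfolding T_def by (intro tendsto_intros LIMSEQ_Suc lim_1_over_n)
  then have T: "T \<longlonglongrightarrow> 0" "\<And>n. 0 < T n" "\<And>n. T n \<le> 1"
    using d order_trans[OF T_le d(2)] by (simp_all add: T_def)
  have aT: "a + T n \<in> I" for n
    using mem_is_interval_1_I[OF I(1) ab(1,2), of "a + T n"] T(2)[of n] T_le[of n] d(3) by simp
  \<comment> \<open>Any exponent strictly between would do: increments of order
    \<open>T powr H1\<close> exceed \<open>T powr h\<close> for small \<open>T\<close>, those of
    order \<open>T powr H2\<close> fall below it.\<close>
  define h where "h = (H1 + H2) / 2"
  have h: "H1 < h" "h < H2"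
    using \<open>H1 < H2\<close> by (auto simp: h_def)
  have proc: "real_process M1 X1" "real_process M2 X2"
    using ds by (auto simp: dilatively_stable_def)
  note law1 = proc(1) cont(1) I(2) and law2 = proc(2) cont(2) I(2)
  define S where "S n = {y::real. T n powr h < \<bar>y\<bar>}" for n
  have S: "S n \<in> sets borel" for n
    unfolding S_def by measurable
  define A where "A n = {f \<in> C_space I. f (a + T n) - f a \<in> S n}" for n
  note [measurable] = evaluation_measurable[OF ab(1)] evaluation_measurable[OF aT] S
  have sets: "sets (path_law M1 X1 I) = sets (borel_C I)" "sets (path_law M2 X2 I) = sets (borel_C I)"
    by (simp_all add: path_law_def)
  interpret P: prob_space "path_law M1 X1 I"
    by (rule prob_space_path_law[OF law1])
  have space: "space (path_law M1 X1 I) = C_space I"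
    using sets_eq_imp_space_eq[OF sets(1)] by (simp add: space_borel_C)
  have "A n \<in> sets (path_law M1 X1 I)" for n
    unfolding A_def sets space_borel_C[symmetric] by measurable
  moreover have "(\<lambda>n. P.prob (space (path_law M1 X1 I) - A n)) \<longlonglongrightarrow> 0"
  proof -
    \<comment> \<open>The complement is again an increment event, now for \<open>- S n\<close>, so
      its probability can be computed from the process.\<close>
    have "space (path_law M1 X1 I) - A n = {f \<in> C_space I. f (a + T n) - f a \<in> - S n}" for n
      by (auto simp: A_def space)
    then have "P.prob (space (path_law M1 X1 I) - A n) =
        measure M1 {\<omega> \<in> space M1. \<bar>X1 (a + T n) \<omega> - X1 a \<omega>\<bar> \<le> T n powr h}" for n
      using measure_path_law_increment[OF law1 ab(1) aT[of n], of "- S n"] borel_comp[OF S[of n]]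
      by (simp add: S_def not_less)
    then show ?thesis
      using increments_rarely_small[OF ds(1) stat(1) zm(1) gauss(1) a T h(1)] by simp
  qed
  moreover have "(\<lambda>n. measure (path_law M2 X2 I) (A n)) \<longlonglongrightarrow> 0"
    using measure_path_law_increment[OF law2 ab(1) aT S]
      increments_rarely_large[OF ds(2) stat(2) zm(2) gauss(2) a T h(2)]
    by (simp add: A_def S_def)
  ultimately obtain B where "B \<in> sets (path_law M1 X1 I)" "emeasure (path_law M1 X1 I) B = 1"
      "emeasure (path_law M2 X2 I) B = 0"
    using P.singular_events[OF prob_space_path_law[OF law2], of A] sets by metis
  then show ?thesis
    unfolding singular_on_def sets by blast
qed

theorem theorem3p2:
  fixes I :: "real set"
    and M1 :: "'a measure" and X1 :: "real \<Rightarrow> 'a \<Rightarrow> real"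
    and M2 :: "'b measure" and X2 :: "real \<Rightarrow> 'b \<Rightarrow> real"
    and H1 \<delta>1 H2 \<delta>2 :: real
  assumes "is_interval I" and "closed I" and "I \<subseteq> {0..}" and "\<exists>a\<in>I. \<exists>b\<in>I. a < b"
    and "dilatively_stable H1 \<delta>1 M1 X1" and "dilatively_stable H2 \<delta>2 M2 X2"
    and "stationary_increments M1 X1" and "stationary_increments M2 X2"
    and "zero_mean M1 X1" and "zero_mean M2 X2"
    and "ae_continuous_paths M1 X1 I" and "ae_continuous_paths M2 X2 I"
    and "\<delta>1 \<ge> 0 \<longrightarrow> has_gaussian_component (distr M1 borel (X1 1))"
    and "\<delta>2 \<ge> 0 \<longrightarrow> has_gaussian_component (distr M2 borel (X2 1))"
    and "H1 \<noteq> H2"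
  shows "singular_on I M1 X1 M2 X2"
proof -
  have proc: "real_process M1 X1" "real_process M2 X2"
    using assms(5,6) by (auto simp: dilatively_stable_def)
  have prob: "prob_space (path_law M1 X1 I)" "prob_space (path_law M2 X2 I)"
    using prob_space_path_law[OF proc(1) assms(11,3)] prob_space_path_law[OF proc(2) assms(12,3)] by auto
  consider "H1 < H2" | "H2 < H1"
    using assms(15) by linarith
  then show ?thesis
  proof cases
    case 1
    show ?thesis
      by (rule singular_on_less[OF assms(1,3-14) 1])
  next
    case 2
    \<comment> \<open>With the processes exchanged, the smaller exponent comes first; symmetry of
      singularity then restores the order.\<close>
    have "singular_on I M2 X2 M1 X1"
      by (rule singular_on_less[OF assms(1,3,4,6,5,8,7,10,9,12,11,14,13) 2])
    then show ?thesis
      by (rule singular_on_commute[OF prob(2,1)])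
  qed
qed

end
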